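(* Let $K\in End_{\mathcal A}^{*}(\mathcal H)$. For $k=1,\dots,n$ let $\{T_{k,w}\}_{w\in\Omega}\subset End_{\mathcal A}^{*}(\mathcal H)$ be a continuous $K$-operator frame for $End_{\mathcal A}^{*}(\mathcal H)$ with bounds $A_k$ and $B_k$, and let $\alpha_1,\dots,\alpha_n$ be any scalars. If there exist a constant $\lambda>0$ and $p\in\{1,\dots,n\}$ such that $$\lambda\,\big\|\{T_{p,w}x\}_{w\in\Omega}\big\|\le\Big\|\sum_{k=1}^n\{\alpha_kT_{k,w}x\}_{w\in\Omega}\Big\|,\qquad x\in\mathcal H,$$ then $\{\sum_{k=1}^n\alpha_kT_{k,w}\}_{w\in\Omega}$ is a continuous $K$-operator frame for $End_{\mathcal A}^{*}(\mathcal H)$. The converse is true for every co-isometry $K$: if $K$ is a co-isometry and $\{\sum_{k=1}^n\alpha_kT_{k,w}\}_{w\in\Omega}$ is a continuous $K$-operator frame for $End_{\mathcal A}^{*}(\mathcal H)$, then there exist $\lambda>0$ and $p\in\{1,\dots,n\}$ such that the displayed inequality holds for all $x\in\mathcal H$.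
   Context: $\mathcal A$ is a unital $C^*$-algebra, $\mathcal H$ is a (left) Hilbert $\mathcal A$-module with $\mathcal A$-valued inner product $\langle\cdot,\cdot\rangle_{\mathcal A}$ ($\mathcal A$-linear in the first variable) and norm $\|x\|=\|\langle x,x\rangle_{\mathcal A}\|^{1/2}$, and $End_{\mathcal A}^{*}(\mathcal H)$ is the set of adjointable operators $\mathcal H\to\mathcal H$. $(\Omega,\mu)$ is a measure space; integrals of Banach-space-valued functions are Bochner integrals. Inequalities between elements of $\mathcal A$ refer to the order given by the positive cone $\mathcal A^+$. Scalars are complex numbers. $K$ is a co-isometry if $KK^*=I$. For a family $\{x_w\}_{w\in\Omega}$ in $\mathcal H$ write $\|\{x_w\}_{w\in\Omega}\|=\big\|\int_\Omega\langle x_w,x_w\rangle_{\mathcal A}\,d\mu(w)\big\|^{1/2}$; sums of families are taken pointwise in $w$. For $K\in End_{\mathcal A}^{*}(\mathcal H)$, a family $\{T_w\}_{w\in\Omega}\subset End_{\mathcal A}^{*}(\mathcal H)$ is a continuous $K$-operator frame for $End_{\mathcal A}^{*}(\mathcal H)$ with (lower and upper) bounds $A,B>0$ if for every $x\in\mathcal H$, $A\langle K^*x,K^*x\rangle_{\mathcal A}\le\int_\Omega\langle T_wx,T_wx\rangle_{\mathcal A}\,d\mu(w)\le B\langle x,x\rangle_{\mathcal A}$. It is called a continuous $K$-operator frame if such $A,B>0$ exist. Convention: for all families of operators considered, $w\mapsto T_{k,w}x$ is measurable for each $x\in\mathcal H$. *)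

theory Defs
  imports "HOL-Analysis.Analysis"
begin

section \<open>Unital C*-algebras\<close>

class scaleC = scaleR +
  fixes scaleC :: "complex \<Rightarrow> 'a \<Rightarrow> 'a"  (infixr \<open>*\<^sub>C\<close> 75)
  assumes scaleR_scaleC: "r *\<^sub>R x = complex_of_real r *\<^sub>C x"

class complex_normed_vector = scaleC + real_normed_vector +
  assumes scaleC_add_right: "c *\<^sub>C (x + y) = c *\<^sub>C x + c *\<^sub>C y"
    and scaleC_add_left: "(c + d) *\<^sub>C x = c *\<^sub>C x + d *\<^sub>C x"
    and scaleC_scaleC: "c *\<^sub>C d *\<^sub>C x = (c * d) *\<^sub>C x"
    and scaleC_one: "1 *\<^sub>C x = x"
    and norm_scaleC: "norm (c *\<^sub>C x) = cmod c * norm x"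

class unital_cstar_algebra = complex_normed_vector + real_normed_algebra_1 + banach +
  fixes star :: "'a \<Rightarrow> 'a"
  assumes mult_scaleC_left: "(c *\<^sub>C a) * b = c *\<^sub>C (a * b)"
    and mult_scaleC_right: "a * (c *\<^sub>C b) = c *\<^sub>C (a * b)"
    and star_star: "star (star a) = a"
    and star_add: "star (a + b) = star a + star b"
    and star_scaleC: "star (c *\<^sub>C a) = cnj c *\<^sub>C star a"
    and star_mult: "star (a * b) = star b * star a"
    and cstar_identity: "norm (star a * a) = (norm a)\<^sup>2"

definition has_two_sided_inverse :: "'a::monoid_mult \<Rightarrow> bool" where
  "has_two_sided_inverse a \<longleftrightarrow> (\<exists>b. a * b = 1 \<and> b * a = 1)"

definition spectrum :: "'a::unital_cstar_algebra \<Rightarrow> complex set" where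
  "spectrum a = {z. \<not> has_two_sided_inverse (z *\<^sub>C 1 - a)}"

definition cstar_positive :: "'a::unital_cstar_algebra \<Rightarrow> bool" where
  "cstar_positive a \<longleftrightarrow> star a = a \<and> spectrum a \<subseteq> \<real>\<^sub>\<ge>\<^sub>0"

definition cstar_le :: "'a::unital_cstar_algebra \<Rightarrow> 'a \<Rightarrow> bool"  (infix \<open>\<preceq>\<close> 50) where
  "a \<preceq> b \<longleftrightarrow> cstar_positive (b - a)"


section \<open>Hilbert modules and adjointable operators\<close>

text \<open>Completeness of the module is the sort constraint \<^class>\<open>banach\<close> together
  with \<open>norm_eq\<close>, which says that the norm of the type is the one induced by the inner product.\<close>

locale hilbert_module =
  fixes act :: "'a::unital_cstar_algebra \<Rightarrow> 'h::{complex_normed_vector, banach} \<Rightarrow> 'h"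
    and ip :: "'h \<Rightarrow> 'h \<Rightarrow> 'a"
  assumes act_add_left: "act (a + b) x = act a x + act b x"
    and act_add_right: "act a (x + y) = act a x + act a y"
    and act_mult: "act (a * b) x = act a (act b x)"
    and act_one: "act 1 x = x"
    and act_scaleC_left: "act (c *\<^sub>C a) x = c *\<^sub>C act a x"
    and act_scaleC_right: "act a (c *\<^sub>C x) = c *\<^sub>C act a x"
    and ip_add_left: "ip (x + y) z = ip x z + ip y z"
    and ip_act_left: "ip (act a x) y = a * ip x y"
    and star_ip: "star (ip x y) = ip y x"
    and ip_positive: "cstar_positive (ip x x)"
    and ip_definite: "ip x x = 0 \<Longrightarrow> x = 0"
    and norm_eq: "norm x = sqrt (norm (ip x x))"

definition adjointable :: "('h \<Rightarrow> 'h \<Rightarrow> 'a) \<Rightarrow> ('h \<Rightarrow> 'h) \<Rightarrow> bool" where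
  "adjointable ip T \<longleftrightarrow> (\<exists>S. \<forall>x y. ip (T x) y = ip x (S y))"

definition adj :: "('h \<Rightarrow> 'h \<Rightarrow> 'a) \<Rightarrow> ('h \<Rightarrow> 'h) \<Rightarrow> 'h \<Rightarrow> 'h" where
  "adj ip T = (THE S. \<forall>x y. ip (T x) y = ip x (S y))"

definition co_isometry :: "('h \<Rightarrow> 'h \<Rightarrow> 'a) \<Rightarrow> ('h \<Rightarrow> 'h) \<Rightarrow> bool" where
  "co_isometry ip K \<longleftrightarrow> K \<circ> adj ip K = id"


section \<open>Bochner integration without separability\<close>

text \<open>The integral of \<open>HOL-Analysis\<close> is restricted to second-countable codomains.  The
  definitions below are its verbatim analogues for arbitrary normed spaces, with Borel
  measurability replaced by strong (Bochner) measurability; by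
  \<open>has_strong_bochner_integral_iff\<close> the two notions agree on Borel measurable functions
  into second-countable spaces.\<close>

definition strongly_measurable :: "'w measure \<Rightarrow> ('w \<Rightarrow> 'b::real_normed_vector) \<Rightarrow> bool" where
  "strongly_measurable M f \<longleftrightarrow>
     (\<exists>s. (\<forall>i. simple_function M (s i)) \<and> (AE w in M. (\<lambda>i::nat. s i w) \<longlonglongrightarrow> f w))"

definition has_strong_bochner_integral ::
    "'w measure \<Rightarrow> ('w \<Rightarrow> 'b::real_normed_vector) \<Rightarrow> 'b \<Rightarrow> bool" where
  "has_strong_bochner_integral M f I \<longleftrightarrow> strongly_measurable M f \<and>
     (\<exists>s. (\<forall>i::nat. Bochner_Integration.simple_bochner_integrable M (s i)) \<and>
          (\<lambda>i. \<integral>\<^sup>+w. norm (f w - s i w) \<partial>M) \<longlonglongrightarrow> 0 \<and>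
          (\<lambda>i. Bochner_Integration.simple_bochner_integral M (s i)) \<longlonglongrightarrow> I)"

definition strong_bochner_integrable ::
    "'w measure \<Rightarrow> ('w \<Rightarrow> 'b::real_normed_vector) \<Rightarrow> bool" where
  "strong_bochner_integrable M f \<longleftrightarrow> (\<exists>I. has_strong_bochner_integral M f I)"

definition strong_bochner_integral ::
    "'w measure \<Rightarrow> ('w \<Rightarrow> 'b::real_normed_vector) \<Rightarrow> 'b" where
  "strong_bochner_integral M f =
     (if strong_bochner_integrable M f then THE I. has_strong_bochner_integral M f I else 0)"

lemma borel_measurable_imp_strongly_measurable:
  fixes f :: "'w \<Rightarrow> 'b::{real_normed_vector, second_countable_topology}"
  assumes "f \<in> borel_measurable M"
  shows "strongly_measurable M f"
proof -
  obtain s where s: "\<And>i. simple_function M (s i)"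
      "\<And>w. w \<in> space M \<Longrightarrow> (\<lambda>i. s i w) \<longlonglongrightarrow> f w"
    using borel_measurable_implies_sequence_metric[OF assms, of 0] by blast
  then have "AE w in M. (\<lambda>i. s i w) \<longlonglongrightarrow> f w"
    by (intro AE_I2)
  with s(1) show ?thesis
    unfolding strongly_measurable_def by blast
qed

lemma has_strong_bochner_integral_iff:
  fixes f :: "'w \<Rightarrow> 'b::{real_normed_vector, second_countable_topology}"
  assumes "f \<in> borel_measurable M"
  shows "has_strong_bochner_integral M f I \<longleftrightarrow> has_bochner_integral M f I"
  using assms borel_measurable_imp_strongly_measurable[OF assms]
  unfolding has_strong_bochner_integral_def has_bochner_integral.simps by blast


section \<open>Continuous operator frames\<close>

text \<open>The index set \<open>\<Omega>\<close> is \<open>space M\<close>; families are total functions on the ambient type and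
  only their values on \<open>space M\<close> matter.\<close>

definition family_norm ::
    "'w measure \<Rightarrow> ('h \<Rightarrow> 'h \<Rightarrow> 'a::unital_cstar_algebra) \<Rightarrow> ('w \<Rightarrow> 'h) \<Rightarrow> real" where
  "family_norm M ip x = sqrt (norm (strong_bochner_integral M (\<lambda>w. ip (x w) (x w))))"

definition continuous_K_operator_frame_with_bounds ::
    "'w measure \<Rightarrow> ('h \<Rightarrow> 'h \<Rightarrow> 'a::unital_cstar_algebra) \<Rightarrow> ('h \<Rightarrow> 'h) \<Rightarrow>
      ('w \<Rightarrow> 'h \<Rightarrow> 'h) \<Rightarrow> real \<Rightarrow> real \<Rightarrow> bool" where
  "continuous_K_operator_frame_with_bounds M ip K T A B \<longleftrightarrow>
     0 < A \<and> 0 < B \<and>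
     (\<forall>w\<in>space M. adjointable ip (T w)) \<and>
     (\<forall>x. strong_bochner_integrable M (\<lambda>w. ip (T w x) (T w x)) \<and>
          A *\<^sub>R ip (adj ip K x) (adj ip K x)
            \<preceq> strong_bochner_integral M (\<lambda>w. ip (T w x) (T w x)) \<and>
          strong_bochner_integral M (\<lambda>w. ip (T w x) (T w x)) \<preceq> B *\<^sub>R ip x x)"

definition continuous_K_operator_frame ::
    "'w measure \<Rightarrow> ('h \<Rightarrow> 'h \<Rightarrow> 'a::unital_cstar_algebra) \<Rightarrow> ('h \<Rightarrow> 'h) \<Rightarrow>
      ('w \<Rightarrow> 'h \<Rightarrow> 'h) \<Rightarrow> bool" where
  "continuous_K_operator_frame M ip K T \<longleftrightarrow>
     (\<exists>A B. continuous_K_operator_frame_with_bounds M ip K T A B)"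

end

theory Submission
  imports Defs
begin

text \<open>
  For a family of operators let \<open>D x\<close> denote the algebra-valued integral of \<open>ip (T w x) (T w x)\<close>; write
  \<open>D\<^sub>k\<close> for the \<open>k\<close>-th frame and \<open>D\<^sub>S\<close> for the combined family.  Frame inequalities compare such
  integrals in the order of the algebra, whereas the hypothesis of the theorem compares their norms.

  The passage from norms to order is the heart of the matter (\<open>quadratic_map_le_of_norm_le\<close>).  The maps \<open>D\<close>
  satisfy \<open>D (a x) = a D(x) a\<^sup>*\<close> and have positive values.  If \<open>norm (D\<^sub>p x) \<le> C norm (D\<^sub>S x)\<close> for all \<open>x\<close>,
  one applies this to \<open>a x\<close>, where \<open>a\<close> is the inverse square root of \<open>D\<^sub>S x + e\<close>: the right-hand side
  is then at most \<open>C\<close>, so \<open>a D\<^sub>p(x) a \<preceq> C\<close>, and undoing the conjugation gives \<open>D\<^sub>p x \<preceq> C (D\<^sub>S x + e)\<close>.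
  With \<open>e\<close> tending to \<open>0\<close>, the lower frame bound of \<open>D\<^sub>p\<close> becomes one for \<open>D\<^sub>S\<close>.  The upper bound for
  \<open>D\<^sub>S\<close> holds for any scalars, by a parallelogram inequality under the integral (\<open>bessel_sum\<close>).

  In the converse direction, \<open>K K\<^sup>* = I\<close> turns \<open>ip (K\<^sup>* x) (K\<^sup>* x)\<close> into \<open>ip x x\<close>.  The lower bound for \<open>D\<^sub>S\<close> and
  the upper bound for \<open>D\<^sub>1\<close> then both compare with \<open>ip x x\<close>, and norms are monotone on positive elements.

  Three facts about C*-algebras carry the argument: the positive elements form a closed convex cone, the norm is
  monotone on it, and conjugation by self-adjoint elements near the unit
  preserves it.  The first two rest on the equality of norm and spectral radius for self-adjoint elements, proved by averaging resolvents over roots of unity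
  (\<open>self_adjoint_norm_one_spectrum\<close>), and the third on a connectedness argument
  (\<open>cstar_positive_conjugate_near_one\<close>).  The integral enters through domination
  (\<open>strong_bochner_integrable_dominated\<close>) and through the fact that the integral of a function with values in a
  closed convex cone lies in the cone (\<open>has_strong_bochner_integral_closed_convex_cone\<close>).
\<close>

section \<open>Strong measurability and the Bochner integral\<close>

lemma ennreal_tendsto_0_le:
  fixes a b :: "nat \<Rightarrow> ennreal"
  assumes "b \<longlonglongrightarrow> 0" "\<And>i. a i \<le> b i"
  shows "a \<longlonglongrightarrow> 0"
  by (rule tendsto_sandwich[of "\<lambda>_. 0" a sequentially b]) (use assms in auto)

lemma strongly_measurable_simple:
  "simple_function M s \<Longrightarrow> strongly_measurable M s"
  unfolding strongly_measurable_def by (rule exI[of _ "\<lambda>_. s"]) auto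

lemma strongly_measurable_compose2:
  assumes "continuous_on UNIV (\<lambda>(x, y). p x y)"
    and "strongly_measurable M f" and "strongly_measurable M g"
  shows "strongly_measurable M (\<lambda>w. p (f w) (g w))"
proof -
  obtain s where s: "\<And>i. simple_function M (s i)" "AE w in M. (\<lambda>i. s i w) \<longlonglongrightarrow> f w"
    using assms(2) unfolding strongly_measurable_def by blast
  obtain t where t: "\<And>i. simple_function M (t i)" "AE w in M. (\<lambda>i. t i w) \<longlonglongrightarrow> g w"
    using assms(3) unfolding strongly_measurable_def by blast
  have "AE w in M. (\<lambda>i. p (s i w) (t i w)) \<longlonglongrightarrow> p (f w) (g w)"
    using s(2) t(2)
  proof eventually_elim
    case (elim w)
    have "(\<lambda>i. (s i w, t i w)) \<longlonglongrightarrow> (f w, g w)"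
      using elim by (intro tendsto_Pair)
    then show ?case
      using continuous_on_tendsto_compose[OF assms(1)] by fastforce
  qed
  moreover have "simple_function M (\<lambda>w. p (s i w) (t i w))" for i
    using s(1) t(1) by (rule simple_function_compose2)
  ultimately show ?thesis
    unfolding strongly_measurable_def by (intro exI[of _ "\<lambda>i w. p (s i w) (t i w)"]) auto
qed

lemma strongly_measurable_add:
  "strongly_measurable M f \<Longrightarrow> strongly_measurable M g \<Longrightarrow> strongly_measurable M (\<lambda>w. f w + g w)"
  by (rule strongly_measurable_compose2) (auto simp: case_prod_beta intro!: continuous_intros)

lemma strongly_measurable_diff:
  "strongly_measurable M f \<Longrightarrow> strongly_measurable M g \<Longrightarrow> strongly_measurable M (\<lambda>w. f w - g w)"
  by (rule strongly_measurable_compose2) (auto simp: case_prod_beta intro!: continuous_intros)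

lemma strongly_measurable_bounded_linear:
  assumes "bounded_linear L" "strongly_measurable M f"
  shows "strongly_measurable M (\<lambda>w. L (f w))"
proof -
  have "continuous_on UNIV (\<lambda>(x, y). L x)"
    by (simp add: case_prod_beta bounded_linear.continuous_on[OF assms(1)] continuous_intros)
  from strongly_measurable_compose2[OF this assms(2) assms(2)] show ?thesis .
qed

lemma strongly_measurable_sum:
  assumes "finite F" "\<And>k. k \<in> F \<Longrightarrow> strongly_measurable M (f k)"
  shows "strongly_measurable M (\<lambda>w. \<Sum>k\<in>F. f k w)"
  using assms
  by (induction F rule: finite_induct) (auto intro: strongly_measurable_add strongly_measurable_simple)

text \<open>The exceptional set of an almost everywhere limit need not be measurable, so the norm of a
  strongly measurable function is Borel only after correction on a null set.  Nonnegative integrals do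
  not see the correction, and this is how additivity and dominated convergence become available for
  \<open>\<integral>\<^sup>+w. norm (f w) \<partial>M\<close>.\<close>

lemma strongly_measurable_norm_AE_borel:
  assumes "strongly_measurable M f"
  obtains h :: "_ \<Rightarrow> real" where "h \<in> borel_measurable M" "AE w in M. norm (f w) = h w"
proof -
  obtain s where s: "\<And>i. simple_function M (s i)" "AE w in M. (\<lambda>i. s i w) \<longlonglongrightarrow> f w"
    using assms unfolding strongly_measurable_def by blast
  obtain N where N: "{w \<in> space M. \<not> (\<lambda>i. s i w) \<longlonglongrightarrow> f w} \<subseteq> N" "N \<in> null_sets M"
    using s(2) by (auto simp: eventually_ae_filter)
  define h where "h w = (if w \<in> N then 0 else norm (f w))" for w
  have "h \<in> borel_measurable M"
  proof (rule borel_measurable_LIMSEQ_real)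
    show "(\<lambda>i. if w \<in> N then 0 else norm (s i w)) \<longlonglongrightarrow> h w" if "w \<in> space M" for w
      proof (cases "w \<in> N")
      case False
      then have "(\<lambda>i. s i w) \<longlonglongrightarrow> f w" using N(1) that by blast
      with False show ?thesis by (simp add: h_def tendsto_norm)
    qed (simp add: h_def)
    show "(\<lambda>w. if w \<in> N then 0 else norm (s i w)) \<in> borel_measurable M" for i
    proof -
      have [measurable]: "(\<lambda>w. norm (s i w)) \<in> borel_measurable M" "N \<in> sets M"
        using borel_measurable_simple_function[OF simple_function_compose1[OF s(1)]] N(2) by auto
      show ?thesis by measurable
    qed
  qed
  moreover have "AE w in M. norm (f w) = h w"
    using AE_not_in[OF N(2)] by eventually_elim (simp add: h_def)
  ultimately show ?thesis using that by blast
qed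

lemma nn_integral_norm_triangle:
  assumes "strongly_measurable M f" "strongly_measurable M g"
  shows "(\<integral>\<^sup>+w. norm (f w + g w) \<partial>M) \<le> (\<integral>\<^sup>+w. norm (f w) \<partial>M) + (\<integral>\<^sup>+w. norm (g w) \<partial>M)"
proof -
  obtain h where h: "h \<in> borel_measurable M" "AE w in M. norm (f w) = h w"
    by (rule strongly_measurable_norm_AE_borel[OF assms(1)])
  obtain k where k: "k \<in> borel_measurable M" "AE w in M. norm (g w) = k w"
    by (rule strongly_measurable_norm_AE_borel[OF assms(2)])
  have "(\<integral>\<^sup>+w. norm (f w + g w) \<partial>M) \<le> (\<integral>\<^sup>+w. ennreal (h w) + ennreal (k w) \<partial>M)"
  proof (rule nn_integral_mono_AE, use h(2) k(2) in eventually_elim)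
    case (elim w)
    have "ennreal (norm (f w + g w)) \<le> ennreal (norm (f w) + norm (g w))"
      by (intro ennreal_leI norm_triangle_ineq)
    also have "\<dots> = ennreal (norm (f w)) + ennreal (norm (g w))"
      by (intro ennreal_plus norm_ge_zero)
    finally show ?case by (simp only: elim)
  qed
  also have "\<dots> = (\<integral>\<^sup>+w. ennreal (h w) \<partial>M) + (\<integral>\<^sup>+w. ennreal (k w) \<partial>M)"
    using h(1) k(1) by (intro nn_integral_add) auto
  also have "(\<integral>\<^sup>+w. ennreal (h w) \<partial>M) = (\<integral>\<^sup>+w. norm (f w) \<partial>M)"
    by (rule nn_integral_cong_AE, use h(2) in eventually_elim) simp
  also have "(\<integral>\<^sup>+w. ennreal (k w) \<partial>M) = (\<integral>\<^sup>+w. norm (g w) \<partial>M)"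
    by (rule nn_integral_cong_AE, use k(2) in eventually_elim) simp
  finally show ?thesis .
qed

lemma strongly_measurable_simple_bochner_integrable:
  "Bochner_Integration.simple_bochner_integrable M s \<Longrightarrow> strongly_measurable M s"
  by (erule Bochner_Integration.simple_bochner_integrable.cases) (rule strongly_measurable_simple)

lemma simple_bochner_integrable_compose:
  assumes "Bochner_Integration.simple_bochner_integrable M s" "p 0 = 0"
  shows "Bochner_Integration.simple_bochner_integrable M (\<lambda>w. p (s w))"
  by (rule simple_bochner_integrable_compose2[where p = "\<lambda>x y. p x", OF assms(2) assms(1) assms(1)])

lemma nn_integral_norm_simple_finite:
  assumes "Bochner_Integration.simple_bochner_integrable M s"
  shows "(\<integral>\<^sup>+w. norm (s w) \<partial>M) < \<infinity>"
proof -
  have "Bochner_Integration.simple_bochner_integrable M (\<lambda>w. norm (s w))"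
    using assms by (rule simple_bochner_integrable_compose) simp
  then have "(\<integral>\<^sup>+w. norm (s w) \<partial>M) = ennreal (Bochner_Integration.simple_bochner_integral M (\<lambda>w. norm (s w)))"
    by (rule simple_bochner_integral_eq_nn_integral[symmetric]) simp
  also have "\<dots> < \<infinity>" by simp
  finally show ?thesis .
qed

lemma simple_bochner_integral_diff_le:
  assumes f: "strongly_measurable M f"
    and s: "Bochner_Integration.simple_bochner_integrable M s"
    and t: "Bochner_Integration.simple_bochner_integrable M t"
  shows "ennreal (norm (Bochner_Integration.simple_bochner_integral M s
             - Bochner_Integration.simple_bochner_integral M t))
    \<le> (\<integral>\<^sup>+w. norm (f w - s w) \<partial>M) + (\<integral>\<^sup>+w. norm (f w - t w) \<partial>M)"
proof -
  have st: "Bochner_Integration.simple_bochner_integrable M (\<lambda>w. s w - t w)"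
    using s t by (rule simple_bochner_integrable_compose2[where p = "(-)", rotated]) simp
  have "norm (Bochner_Integration.simple_bochner_integral M s
             - Bochner_Integration.simple_bochner_integral M t)
      \<le> Bochner_Integration.simple_bochner_integral M (\<lambda>w. norm (s w - t w))"
    using simple_bochner_integral_norm_bound[OF st] simple_bochner_integral_diff[OF s t] by simp
  moreover have "Bochner_Integration.simple_bochner_integrable M (\<lambda>w. norm (s w - t w))"
    using st by (rule simple_bochner_integrable_compose) simp
  then have "ennreal (Bochner_Integration.simple_bochner_integral M (\<lambda>w. norm (s w - t w)))
      = (\<integral>\<^sup>+w. norm (s w - t w) \<partial>M)"
    by (rule simple_bochner_integral_eq_nn_integral) simp
  ultimately have "ennreal (norm (Bochner_Integration.simple_bochner_integral M s
             - Bochner_Integration.simple_bochner_integral M t)) \<le> (\<integral>\<^sup>+w. norm (s w - t w) \<partial>M)"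
    by (metis ennreal_leI)
  also have "\<dots> = (\<integral>\<^sup>+w. norm ((s w - f w) + (f w - t w)) \<partial>M)"
    by simp
  also have "\<dots> \<le> (\<integral>\<^sup>+w. norm (s w - f w) \<partial>M) + (\<integral>\<^sup>+w. norm (f w - t w) \<partial>M)"
    by (intro nn_integral_norm_triangle strongly_measurable_diff f
        strongly_measurable_simple_bochner_integrable[OF s] strongly_measurable_simple_bochner_integrable[OF t])
  also have "\<dots> = (\<integral>\<^sup>+w. norm (f w - s w) \<partial>M) + (\<integral>\<^sup>+w. norm (f w - t w) \<partial>M)"
    by (simp add: norm_minus_commute)
  finally show ?thesis .
qed

lemma has_strong_bochner_integralI:
  assumes "strongly_measurable M f"
    and "\<And>i. Bochner_Integration.simple_bochner_integrable M (s i)"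
    and "(\<lambda>i::nat. \<integral>\<^sup>+w. norm (f w - s i w) \<partial>M) \<longlonglongrightarrow> 0"
    and "(\<lambda>i. Bochner_Integration.simple_bochner_integral M (s i)) \<longlonglongrightarrow> I"
  shows "has_strong_bochner_integral M f I"
  using assms unfolding has_strong_bochner_integral_def by blast

lemma has_strong_bochner_integral_cong:
  assumes f: "has_strong_bochner_integral M f I" and eq: "\<And>w. w \<in> space M \<Longrightarrow> f w = g w"
  shows "has_strong_bochner_integral M g I"
proof -
  obtain s where s: "\<And>i. Bochner_Integration.simple_bochner_integrable M (s i)"
      "(\<lambda>i. \<integral>\<^sup>+w. norm (f w - s i w) \<partial>M) \<longlonglongrightarrow> 0"
      "(\<lambda>i. Bochner_Integration.simple_bochner_integral M (s i)) \<longlonglongrightarrow> I"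
    using f unfolding has_strong_bochner_integral_def by blast
  obtain u where u: "\<And>i. simple_function M (u i)" "AE w in M. (\<lambda>i. u i w) \<longlonglongrightarrow> f w"
    using f unfolding has_strong_bochner_integral_def strongly_measurable_def by blast
  have "AE w in M. (\<lambda>i. u i w) \<longlonglongrightarrow> g w"
    using u(2) AE_space by eventually_elim (simp add: eq)
  with u(1) have "strongly_measurable M g" unfolding strongly_measurable_def by blast
  moreover have "(\<integral>\<^sup>+w. norm (f w - s i w) \<partial>M) = (\<integral>\<^sup>+w. norm (g w - s i w) \<partial>M)" for i
    by (intro nn_integral_cong) (simp add: eq)
  ultimately show ?thesis using has_strong_bochner_integralI[OF _ s(1) _ s(3)] s(2) by simp
qed

lemma has_strong_bochner_integral_unique:
  assumes "has_strong_bochner_integral M f I" "has_strong_bochner_integral M f J"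
  shows "I = J"
proof -
  have f: "strongly_measurable M f"
    using assms(1) unfolding has_strong_bochner_integral_def by blast
  obtain s where s: "\<And>i. Bochner_Integration.simple_bochner_integrable M (s i)"
      "(\<lambda>i. \<integral>\<^sup>+w. norm (f w - s i w) \<partial>M) \<longlonglongrightarrow> 0"
      "(\<lambda>i. Bochner_Integration.simple_bochner_integral M (s i)) \<longlonglongrightarrow> I"
    using assms(1) unfolding has_strong_bochner_integral_def by blast
  obtain t where t: "\<And>i. Bochner_Integration.simple_bochner_integrable M (t i)"
      "(\<lambda>i. \<integral>\<^sup>+w. norm (f w - t i w) \<partial>M) \<longlonglongrightarrow> 0"
      "(\<lambda>i. Bochner_Integration.simple_bochner_integral M (t i)) \<longlonglongrightarrow> J"
    using assms(2) unfolding has_strong_bochner_integral_def by blast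
  have "ennreal (norm (I - J)) \<le> 0 + 0"
  proof (rule LIMSEQ_le)
    show "(\<lambda>i. ennreal (norm (Bochner_Integration.simple_bochner_integral M (s i)
             - Bochner_Integration.simple_bochner_integral M (t i)))) \<longlonglongrightarrow> ennreal (norm (I - J))"
      by (intro tendsto_ennrealI tendsto_norm tendsto_diff s t)
    show "(\<lambda>i. (\<integral>\<^sup>+w. norm (f w - s i w) \<partial>M) + (\<integral>\<^sup>+w. norm (f w - t i w) \<partial>M)) \<longlonglongrightarrow> 0 + 0"
      by (intro tendsto_add s t)
  qed (use simple_bochner_integral_diff_le[OF f s(1) t(1)] in blast)
  then show ?thesis by simp
qed

lemma strong_bochner_integral_eq:
  assumes "has_strong_bochner_integral M f I"
  shows "strong_bochner_integral M f = I"
proof -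
  have "(THE J. has_strong_bochner_integral M f J) = I"
    using assms by (rule the_equality) (rule has_strong_bochner_integral_unique[OF _ assms])
  with assms show ?thesis
    unfolding strong_bochner_integral_def strong_bochner_integrable_def by auto
qed

lemma has_strong_bochner_integral_integral:
  "strong_bochner_integrable M f \<Longrightarrow> has_strong_bochner_integral M f (strong_bochner_integral M f)"
  using strong_bochner_integral_eq unfolding strong_bochner_integrable_def by metis

text \<open>By \<open>simple_bochner_integral_diff_le\<close>, simple functions that converge to \<open>f\<close> in mean have
  Cauchy integrals; completeness of the codomain then supplies the integral of \<open>f\<close>.\<close>

lemma has_strong_bochner_integral_limit:
  fixes f :: "'w \<Rightarrow> 'b::banach"
  assumes f: "strongly_measurable M f"
    and s: "\<And>i. Bochner_Integration.simple_bochner_integrable M (s i)"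
    and lim: "(\<lambda>i. \<integral>\<^sup>+w. norm (f w - s i w) \<partial>M) \<longlonglongrightarrow> 0"
  obtains I where "has_strong_bochner_integral M f I"
    "(\<lambda>i. Bochner_Integration.simple_bochner_integral M (s i)) \<longlonglongrightarrow> I"
proof -
  have "Cauchy (\<lambda>i. Bochner_Integration.simple_bochner_integral M (s i))"
  proof (rule metric_CauchyI)
    fix e :: real assume "0 < e"
    then have "eventually (\<lambda>i. (\<integral>\<^sup>+w. norm (f w - s i w) \<partial>M) < ennreal (e/2)) sequentially"
      using lim by (intro order_tendstoD) auto
    then obtain N where N: "\<And>i. i \<ge> N \<Longrightarrow> (\<integral>\<^sup>+w. norm (f w - s i w) \<partial>M) < ennreal (e/2)"
      by (auto simp: eventually_sequentially)
    have "norm (Bochner_Integration.simple_bochner_integral M (s i)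
        - Bochner_Integration.simple_bochner_integral M (s j)) < e" if "i \<ge> N" "j \<ge> N" for i j
    proof -
      have "ennreal (norm (Bochner_Integration.simple_bochner_integral M (s i)
          - Bochner_Integration.simple_bochner_integral M (s j))) < ennreal (e/2) + ennreal (e/2)"
        by (rule le_less_trans[OF simple_bochner_integral_diff_le[OF f s s]])
          (intro add_strict_mono N that)
      also have "\<dots> = ennreal e"
        using \<open>0 < e\<close> by (simp flip: ennreal_plus)
      finally show ?thesis by (simp add: ennreal_less_iff)
    qed
    then show "\<exists>N. \<forall>i\<ge>N. \<forall>j\<ge>N. dist (Bochner_Integration.simple_bochner_integral M (s i))
        (Bochner_Integration.simple_bochner_integral M (s j)) < e"
      by (auto simp: dist_norm)
  qed
  then obtain I where I: "(\<lambda>i. Bochner_Integration.simple_bochner_integral M (s i)) \<longlonglongrightarrow> I"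
    using Cauchy_convergent convergent_def by blast
  with assms have "has_strong_bochner_integral M f I"
    unfolding has_strong_bochner_integral_def by blast
  with I show ?thesis using that by blast
qed

lemma has_strong_bochner_integral_add:
  assumes "has_strong_bochner_integral M f I" "has_strong_bochner_integral M g J"
  shows "has_strong_bochner_integral M (\<lambda>w. f w + g w) (I + J)"
proof -
  obtain s where f: "strongly_measurable M f" 
      and s: "\<And>i. Bochner_Integration.simple_bochner_integrable M (s i)"
      "(\<lambda>i. \<integral>\<^sup>+w. norm (f w - s i w) \<partial>M) \<longlonglongrightarrow> 0"
      "(\<lambda>i. Bochner_Integration.simple_bochner_integral M (s i)) \<longlonglongrightarrow> I"
    using assms(1) unfolding has_strong_bochner_integral_def by blast
  obtain t where g: "strongly_measurable M g" 
      and t: "\<And>i. Bochner_Integration.simple_bochner_integrable M (t i)"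
      "(\<lambda>i. \<integral>\<^sup>+w. norm (g w - t i w) \<partial>M) \<longlonglongrightarrow> 0"
      "(\<lambda>i. Bochner_Integration.simple_bochner_integral M (t i)) \<longlonglongrightarrow> J"
    using assms(2) unfolding has_strong_bochner_integral_def by blast
  have "(\<lambda>i. \<integral>\<^sup>+w. norm ((f w + g w) - (s i w + t i w)) \<partial>M) \<longlonglongrightarrow> 0"
  proof (rule ennreal_tendsto_0_le)
    show "(\<lambda>i. (\<integral>\<^sup>+w. norm (f w - s i w) \<partial>M) + (\<integral>\<^sup>+w. norm (g w - t i w) \<partial>M)) \<longlonglongrightarrow> 0"
      using tendsto_add[OF s(2) t(2)] by simp
    show "(\<integral>\<^sup>+w. norm ((f w + g w) - (s i w + t i w)) \<partial>M)
        \<le> (\<integral>\<^sup>+w. norm (f w - s i w) \<partial>M) + (\<integral>\<^sup>+w. norm (g w - t i w) \<partial>M)" for i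
      unfolding add_diff_add
      by (intro nn_integral_norm_triangle strongly_measurable_diff f g
          strongly_measurable_simple_bochner_integrable[OF s(1)]
          strongly_measurable_simple_bochner_integrable[OF t(1)])
  qed
  moreover have "Bochner_Integration.simple_bochner_integrable M (\<lambda>w. s i w + t i w)" for i
    using s(1) t(1) by (rule simple_bochner_integrable_compose2[where p = "(+)", rotated]) simp
  moreover have "(\<lambda>i. Bochner_Integration.simple_bochner_integral M (\<lambda>w. s i w + t i w)) \<longlonglongrightarrow> I + J"
    using tendsto_add[OF s(3) t(3)] simple_bochner_integral_add[OF s(1) t(1)] by simp
  ultimately show ?thesis
    using has_strong_bochner_integralI[OF strongly_measurable_add[OF f g],
        where s = "\<lambda>i w. s i w + t i w"] by blast
qed

lemma has_strong_bochner_integral_bounded_linear: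
  assumes "bounded_linear L" "has_strong_bochner_integral M f I"
  shows "has_strong_bochner_integral M (\<lambda>w. L (f w)) (L I)"
proof -
  interpret L: bounded_linear L by fact
  obtain s where f: "strongly_measurable M f" 
      and s: "\<And>i. Bochner_Integration.simple_bochner_integrable M (s i)"
      "(\<lambda>i. \<integral>\<^sup>+w. norm (f w - s i w) \<partial>M) \<longlonglongrightarrow> 0"
      "(\<lambda>i. Bochner_Integration.simple_bochner_integral M (s i)) \<longlonglongrightarrow> I"
    using assms(2) unfolding has_strong_bochner_integral_def by blast
  obtain C where C: "C \<ge> 0" "\<And>x. norm (L x) \<le> norm x * C"
    using L.nonneg_bounded by blast
  have le: "(\<integral>\<^sup>+w. norm (L (f w) - L (s i w)) \<partial>M) \<le> ennreal C * (\<integral>\<^sup>+w. norm (f w - s i w) \<partial>M)" for i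
  proof -
    obtain h where h: "h \<in> borel_measurable M" "AE w in M. norm (f w - s i w) = h w"
      by (rule strongly_measurable_norm_AE_borel[OF strongly_measurable_diff[OF f
            strongly_measurable_simple_bochner_integrable[OF s(1)[of i]]]])
    have "(\<integral>\<^sup>+w. norm (L (f w) - L (s i w)) \<partial>M) \<le> (\<integral>\<^sup>+w. ennreal C * ennreal (h w) \<partial>M)"
    proof (rule nn_integral_mono_AE, use h(2) in eventually_elim)
      case (elim w)
      have "norm (L (f w) - L (s i w)) \<le> C * norm (f w - s i w)"
        using C(2)[of "f w - s i w"] by (simp add: L.diff mult.commute)
      then show ?case using elim C(1) by (simp add: ennreal_mult'[symmetric] ennreal_leI)
    qed
    also have "\<dots> = ennreal C * (\<integral>\<^sup>+w. h w \<partial>M)"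
      using h(1) by (intro nn_integral_cmult) auto
    also have "(\<integral>\<^sup>+w. h w \<partial>M) = (\<integral>\<^sup>+w. norm (f w - s i w) \<partial>M)"
      by (rule nn_integral_cong_AE, use h(2) in eventually_elim) simp
    finally show ?thesis .
  qed
  have "(\<lambda>i. \<integral>\<^sup>+w. norm (L (f w) - L (s i w)) \<partial>M) \<longlonglongrightarrow> 0"
  proof (rule ennreal_tendsto_0_le)
    show "(\<lambda>i. ennreal C * (\<integral>\<^sup>+w. norm (f w - s i w) \<partial>M)) \<longlonglongrightarrow> 0"
      using ennreal_tendsto_cmult[OF _ s(2), of "ennreal C"] by simp
  qed (rule le)
  moreover have "Bochner_Integration.simple_bochner_integrable M (\<lambda>w. L (s i w))" for i
    using s(1) by (rule simple_bochner_integrable_compose) (rule L.zero)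
  moreover have "(\<lambda>i. Bochner_Integration.simple_bochner_integral M (\<lambda>w. L (s i w))) \<longlonglongrightarrow> L I"
    using L.tendsto[OF s(3)] simple_bochner_integral_linear[OF L.linear s(1)] by simp
  ultimately show ?thesis
    using has_strong_bochner_integralI[OF strongly_measurable_bounded_linear[OF assms(1) f],
        where s = "\<lambda>i w. L (s i w)"] by blast
qed

lemma has_strong_bochner_integral_diff:
  assumes "has_strong_bochner_integral M f I" "has_strong_bochner_integral M g J"
  shows "has_strong_bochner_integral M (\<lambda>w. f w - g w) (I - J)"
  using has_strong_bochner_integral_add[OF assms(1)
      has_strong_bochner_integral_bounded_linear[OF bounded_linear_minus[OF bounded_linear_ident] assms(2)]]
  by simp

lemma has_strong_bochner_integral_zero:
  "has_strong_bochner_integral (M :: 'w measure) (\<lambda>w. 0 :: 'b::real_normed_vector) 0"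
proof -
  have "Bochner_Integration.simple_bochner_integrable M (\<lambda>w. 0 :: 'b)"
    by (rule Bochner_Integration.simple_bochner_integrable.intros) auto
  moreover have "Bochner_Integration.simple_bochner_integral M (\<lambda>w. 0 :: 'b) = 0"
    unfolding Bochner_Integration.simple_bochner_integral_def by (intro sum.neutral) auto
  ultimately show ?thesis
    by (intro has_strong_bochner_integralI[where s = "\<lambda>i w. 0"] strongly_measurable_simple) auto
qed

lemma has_strong_bochner_integral_sum:
  assumes "finite F" "\<And>k. k \<in> F \<Longrightarrow> has_strong_bochner_integral M (f k) (I k)"
  shows "has_strong_bochner_integral M (\<lambda>w. \<Sum>k\<in>F. f k w) (\<Sum>k\<in>F. I k)"
  using assms
  by (induction F rule: finite_induct)
    (auto intro: has_strong_bochner_integral_add has_strong_bochner_integral_zero)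

lemma has_strong_bochner_integral_norm_finite:
  assumes "has_strong_bochner_integral M g I"
  shows "(\<integral>\<^sup>+w. norm (g w) \<partial>M) < \<infinity>"
proof -
  obtain s where g: "strongly_measurable M g" 
      and s: "\<And>i. Bochner_Integration.simple_bochner_integrable M (s i)"
      "(\<lambda>i. \<integral>\<^sup>+w. norm (g w - s i w) \<partial>M) \<longlonglongrightarrow> 0"
    using assms unfolding has_strong_bochner_integral_def by blast
  obtain i :: nat where i: "(\<integral>\<^sup>+w. norm (g w - s i w) \<partial>M) < 1"
    using order_tendstoD(2)[OF s(2), of 1] by (auto simp: eventually_sequentially)
  have "(\<integral>\<^sup>+w. norm (g w) \<partial>M) = (\<integral>\<^sup>+w. norm ((g w - s i w) + s i w) \<partial>M)"
    by simp
  also have "\<dots> \<le> (\<integral>\<^sup>+w. norm (g w - s i w) \<partial>M) + (\<integral>\<^sup>+w. norm (s i w) \<partial>M)"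
    by (intro nn_integral_norm_triangle strongly_measurable_diff g
        strongly_measurable_simple_bochner_integrable[OF s(1)])
  also have "\<dots> < \<infinity>"
    using nn_integral_norm_simple_finite[OF s(1)] i
    by (auto simp: ennreal_add_less_top intro: order_less_trans)
  finally show ?thesis .
qed

text \<open>Simple functions that converge pointwise to \<open>f\<close> are cut off to \<open>0\<close> wherever their norm
  exceeds \<open>2 * norm (f w)\<close>.  The limit is unchanged, for at a point with \<open>f w \<noteq> 0\<close> the cut stops
  acting eventually, and at a zero of \<open>f\<close> it leaves only the value \<open>0\<close>.  The cut-off functions are
  dominated by a multiple of \<open>norm (f w)\<close>, so they converge in mean.\<close>

lemma strong_bochner_integrable_dominated:
  fixes f :: "'w \<Rightarrow> 'b::banach"
  assumes f: "strongly_measurable M f" and g: "has_strong_bochner_integral M g J"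
    and le: "\<And>w. w \<in> space M \<Longrightarrow> norm (f w) \<le> norm (g w)"
  shows "strong_bochner_integrable M f"
proof -
  obtain s where s: "\<And>i. simple_function M (s i)" "AE w in M. (\<lambda>i. s i w) \<longlonglongrightarrow> f w"
    using f unfolding strongly_measurable_def by blast
  obtain h where h: "h \<in> borel_measurable M" "AE w in M. norm (f w) = h w"
    by (rule strongly_measurable_norm_AE_borel[OF f])
  note [measurable] = h(1)
  have [measurable]: "(\<lambda>w. norm (s i w)) \<in> borel_measurable M" for i
    using s(1) by (rule borel_measurable_simple_function[OF simple_function_compose1])
  have "(\<integral>\<^sup>+w. h w \<partial>M) = (\<integral>\<^sup>+w. norm (f w) \<partial>M)"
    by (rule nn_integral_cong_AE, use h(2) in eventually_elim) simp
  also have "\<dots> \<le> (\<integral>\<^sup>+w. norm (g w) \<partial>M)"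
    using le by (intro nn_integral_mono ennreal_leI)
  also have "\<dots> < \<infinity>" by (rule has_strong_bochner_integral_norm_finite[OF g])
  finally have hfin: "(\<integral>\<^sup>+w. h w \<partial>M) < \<infinity>" .
  have mfin: "(\<integral>\<^sup>+w. ennreal c * ennreal (h w) \<partial>M) < \<infinity>" for c
  proof -
    have "(\<integral>\<^sup>+w. ennreal c * ennreal (h w) \<partial>M) = ennreal c * (\<integral>\<^sup>+w. h w \<partial>M)"
      by (intro nn_integral_cmult) auto
    then show ?thesis using hfin by (simp add: ennreal_mult_less_top)
  qed
  \<comment> \<open>\<open>h\<close> replaces \<open>norm (f w)\<close> in the cut-off, so that the set where it acts is measurable\<close>
  define t where "t i w = (if norm (s i w) \<le> 2 * h w then s i w else 0)" for i w
  have t_le: "norm (t i w) \<le> 2 * \<bar>h w\<bar>" for i w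
    by (auto simp: t_def)
  have t: "simple_function M (t i)" for i
  proof -
    have "simple_function M (\<lambda>w. if w \<in> {w\<in>space M. norm (s i w) \<le> 2 * h w} then s i w else 0)"
      using s(1) by (intro simple_function_If_set) auto
    then show ?thesis
      by (rule simple_function_cong[THEN iffD1, rotated]) (auto simp: t_def)
  qed
  have tb: "Bochner_Integration.simple_bochner_integrable M (t i)" for i
  proof (rule simple_bochner_integrableI_bounded[OF t])
    have "(\<integral>\<^sup>+w. norm (t i w) \<partial>M) \<le> (\<integral>\<^sup>+w. ennreal 2 * ennreal (h w) \<partial>M)"
    proof (rule nn_integral_mono_AE, use h(2) in eventually_elim)
      case (elim w)
      then have "0 \<le> h w" by (metis norm_ge_zero)
      then show ?case
        using t_le[of i w] by (simp add: ennreal_mult'[symmetric] ennreal_leI del: ennreal_numeral)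
    qed
    then show "(\<integral>\<^sup>+w. norm (t i w) \<partial>M) < \<infinity>"
      using mfin le_less_trans by blast
  qed
  have "\<exists>d. d \<in> borel_measurable M \<and> (AE w in M. norm (f w - t i w) = (d w :: real))" for i
    using strongly_measurable_norm_AE_borel[OF strongly_measurable_diff[OF f
            strongly_measurable_simple[OF t[of i]]]] by blast
  then obtain d :: "nat \<Rightarrow> 'w \<Rightarrow> real" where d: "\<And>i. d i \<in> borel_measurable M"
      "\<And>i. AE w in M. norm (f w - t i w) = d i w"
    by metis
  have "(\<lambda>i. \<integral>\<^sup>+w. ennreal (d i w) \<partial>M) \<longlonglongrightarrow> (\<integral>\<^sup>+w. 0 \<partial>M)"
  proof (rule nn_integral_dominated_convergence)
    show "(\<lambda>w. ennreal (d i w)) \<in> borel_measurable M" for i using d(1) by measurable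
    show "(\<lambda>w. ennreal 3 * ennreal (h w)) \<in> borel_measurable M" by measurable
    show "AE w in M. ennreal (d i w) \<le> ennreal 3 * ennreal (h w)" for i
      using h(2) d(2)[of i]
    proof eventually_elim
      case (elim w)
      then have "0 \<le> h w" by (metis norm_ge_zero)
      moreover have "d i w \<le> norm (f w) + norm (t i w)"
        using elim norm_triangle_ineq4 by metis
      ultimately show ?case
        using t_le[of i w] elim
        by (simp add: ennreal_mult'[symmetric] ennreal_leI del: ennreal_numeral)
    qed
    show "AE w in M. (\<lambda>i. ennreal (d i w)) \<longlonglongrightarrow> 0"
    proof -
      have "AE w in M. \<forall>i. norm (f w - t i w) = d i w"
        using d(2) by (simp add: AE_all_countable)
      then show ?thesis
        using s(2) h(2)
      proof eventually_elim
        case (elim w)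
        have "(\<lambda>i. t i w) \<longlonglongrightarrow> f w"
        proof (cases "f w = 0")
          case True
          then have "h w = 0" using elim(3) by simp
          then have "norm (t i w) \<le> 0" for i using t_le[of i w] by simp
          then have "t i w = 0" for i by simp
          then show ?thesis using True by simp
        next
          case False
          then have "0 < h w" using elim(3) by (metis zero_less_norm_iff)
          then have "norm (f w) < 2 * h w" using elim(3) by simp
          then have "\<forall>\<^sub>F i in sequentially. norm (s i w) < 2 * h w"
            using tendsto_norm[OF elim(2)] by (rule order_tendstoD(2)[rotated])
          then have "\<forall>\<^sub>F i in sequentially. s i w = t i w"
            by eventually_elim (simp add: t_def)
          then show ?thesis using elim(2) by (rule Lim_transform_eventually[rotated])
        qed
        then have "(\<lambda>i. norm (f w - t i w)) \<longlonglongrightarrow> norm (f w - f w)"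
          by (intro tendsto_intros)
        then have "(\<lambda>i. d i w) \<longlonglongrightarrow> 0" using elim(1) by simp
        then show ?case using tendsto_ennrealI by fastforce
      qed
    qed
  qed (use mfin[of 3] in auto)
  moreover have "(\<integral>\<^sup>+w. ennreal (d i w) \<partial>M) = (\<integral>\<^sup>+w. norm (f w - t i w) \<partial>M)" for i
    by (rule nn_integral_cong_AE, use d(2)[of i] in eventually_elim) simp
  ultimately have "(\<lambda>i. \<integral>\<^sup>+w. norm (f w - t i w) \<partial>M) \<longlonglongrightarrow> 0" by simp
  from has_strong_bochner_integral_limit[OF f tb this] show ?thesis
    unfolding strong_bochner_integrable_def by blast
qed

text \<open>Simple approximations of a cone-valued function need not take values in the cone.  Each value
  \<open>v\<close> is moved to a point \<open>p v\<close> of the cone at no more than twice the distance from \<open>v\<close> to the cone.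
  As \<open>f w\<close> itself lies in the cone, that distance is at most \<open>norm (f w - v)\<close>, so the moved functions
  still converge in mean to \<open>f\<close>, and their integrals are finite conic combinations of points of the cone.\<close>

lemma has_strong_bochner_integral_closed_convex_cone:
  fixes C :: "'b::banach set"
  assumes C: "closed C" "0 \<in> C" "\<And>x y. x \<in> C \<Longrightarrow> y \<in> C \<Longrightarrow> x + y \<in> C"
      "\<And>r x. 0 \<le> r \<Longrightarrow> x \<in> C \<Longrightarrow> r *\<^sub>R x \<in> C"
    and f: "has_strong_bochner_integral M f I" and fC: "\<And>w. w \<in> space M \<Longrightarrow> f w \<in> C"
  shows "I \<in> C"
proof -
  obtain s where fm: "strongly_measurable M f" 
      and s: "\<And>i. Bochner_Integration.simple_bochner_integrable M (s i)"
      "(\<lambda>i. \<integral>\<^sup>+w. norm (f w - s i w) \<partial>M) \<longlonglongrightarrow> 0"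
    using f unfolding has_strong_bochner_integral_def by blast
  have "\<exists>c\<in>C. norm (v - c) \<le> 2 * infdist v C" for v
  \<comment> \<open>a nearest point need not exist; the factor \<open>2\<close> makes room for an almost nearest one\<close>
  proof (cases "infdist v C = 0")
    case True
    then have "v \<in> C" using C(1,2) in_closed_iff_infdist_zero by blast
    then show ?thesis using True by force
  next
    case False
    then have "infdist v C < 2 * infdist v C" using infdist_nonneg[of v C] by simp
    then have "(INF c\<in>C. dist v c) < 2 * infdist v C"
      using C(2) unfolding infdist_def by (auto split: if_splits)
    then obtain c where "c \<in> C" "dist v c < 2 * infdist v C"
      using cInf_lessD[of "dist v ` C"] C(2) by auto
    then show ?thesis by (intro bexI[of _ c]) (auto simp: dist_norm)
  qed
  then obtain p where p: "\<And>v. p v \<in> C" "\<And>v. norm (v - p v) \<le> 2 * infdist v C"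
    by metis
  have p0: "p 0 = 0" using p(2)[of 0] C(2) by simp
  have near: "norm (f w - p (s i w)) \<le> 3 * norm (f w - s i w)" if "w \<in> space M" for w i
  proof -
    have "infdist (s i w) C \<le> norm (f w - s i w)"
      using infdist_le[OF fC[OF that], of "s i w"] by (simp add: dist_norm norm_minus_commute)
    moreover have "norm (f w - p (s i w)) \<le> norm (f w - s i w) + norm (s i w - p (s i w))"
      using norm_triangle_ineq[of "f w - s i w" "s i w - p (s i w)"] by simp
    ultimately show ?thesis using p(2)[of "s i w"] by linarith
  qed
  have le: "(\<integral>\<^sup>+w. norm (f w - p (s i w)) \<partial>M) \<le> ennreal 3 * (\<integral>\<^sup>+w. norm (f w - s i w) \<partial>M)" for i
  proof -
    obtain h where h: "h \<in> borel_measurable M" "AE w in M. norm (f w - s i w) = h w"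
      by (rule strongly_measurable_norm_AE_borel[OF strongly_measurable_diff[OF fm
            strongly_measurable_simple_bochner_integrable[OF s(1)[of i]]]])
    have "(\<integral>\<^sup>+w. norm (f w - p (s i w)) \<partial>M) \<le> (\<integral>\<^sup>+w. ennreal 3 * ennreal (h w) \<partial>M)"
    proof (rule nn_integral_mono_AE, use h(2) AE_space in eventually_elim)
      case (elim w)
      then show ?case
        using near[of w i] by (simp add: ennreal_mult'[symmetric] ennreal_leI del: ennreal_numeral)
    qed
    also have "\<dots> = ennreal 3 * (\<integral>\<^sup>+w. h w \<partial>M)"
      using h(1) by (intro nn_integral_cmult) auto
    also have "(\<integral>\<^sup>+w. h w \<partial>M) = (\<integral>\<^sup>+w. norm (f w - s i w) \<partial>M)"
      by (rule nn_integral_cong_AE, use h(2) in eventually_elim) simp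
    finally show ?thesis .
  qed
  have "(\<lambda>i. \<integral>\<^sup>+w. norm (f w - p (s i w)) \<partial>M) \<longlonglongrightarrow> 0"
  proof (rule ennreal_tendsto_0_le)
    show "(\<lambda>i. ennreal 3 * (\<integral>\<^sup>+w. norm (f w - s i w) \<partial>M)) \<longlonglongrightarrow> 0"
      using ennreal_tendsto_cmult[OF _ s(2), of "ennreal 3"] by simp
  qed (rule le)
  then obtain J where J: "has_strong_bochner_integral M f J"
      "(\<lambda>i. Bochner_Integration.simple_bochner_integral M (\<lambda>w. p (s i w))) \<longlonglongrightarrow> J"
    by (rule has_strong_bochner_integral_limit[OF fm simple_bochner_integrable_compose[where p = p, OF s(1) p0]])
  have sumC: "(\<Sum>y\<in>F. m y *\<^sub>R y) \<in> C" if "F \<subseteq> C" "\<And>y. 0 \<le> m y" for F and m :: "'b \<Rightarrow> real"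
  proof (cases "finite F")
    case True
    then show ?thesis using that(1)
      by (induction F rule: finite_induct) (auto intro!: C(2-4) that(2))
  qed (simp add: C(2))
  have "Bochner_Integration.simple_bochner_integral M (\<lambda>w. p (s i w)) \<in> C" for i
    unfolding Bochner_Integration.simple_bochner_integral_def
    by (rule sumC) (auto simp: p(1))
  then have "J \<in> C" using closed_sequentially[OF C(1) _ J(2)] by blast
  with has_strong_bochner_integral_unique[OF f J(1)] show ?thesis by simp
qed

section \<open>Scalar multiplication and involution\<close>

lemma scaleC_zero_left [simp]: "0 *\<^sub>C (x::'a::complex_normed_vector) = 0"
  using scaleR_scaleC[of 0 x] by simp

lemma scaleC_zero_right [simp]: "c *\<^sub>C (0::'a::complex_normed_vector) = 0"
  using scaleC_add_right[of c "0::'a" 0] by simp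

lemma scaleC_minus_left: "(- c) *\<^sub>C (x::'a::complex_normed_vector) = - (c *\<^sub>C x)"
  using scaleC_add_left[of c "- c" x] by (simp add: eq_neg_iff_add_eq_0 add.commute)

lemma scaleC_minus_right: "c *\<^sub>C (- x::'a::complex_normed_vector) = - (c *\<^sub>C x)"
  using scaleC_add_right[of c x "- x"] by (simp add: eq_neg_iff_add_eq_0 add.commute)

lemma scaleC_diff_left: "(c - d) *\<^sub>C (x::'a::complex_normed_vector) = c *\<^sub>C x - d *\<^sub>C x"
  using scaleC_add_left[of c "- d" x] by (simp add: scaleC_minus_left)

lemma scaleC_diff_right: "c *\<^sub>C (x - y::'a::complex_normed_vector) = c *\<^sub>C x - c *\<^sub>C y"
  using scaleC_add_right[of c x "- y"] by (simp add: scaleC_minus_right)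

lemma bounded_linear_scaleC: "bounded_linear (\<lambda>x::'a::complex_normed_vector. c *\<^sub>C x)"
proof (rule bounded_linear_intro)
  show "c *\<^sub>C (r *\<^sub>R x) = r *\<^sub>R (c *\<^sub>C x)" for r and x :: 'a
    by (simp add: scaleR_scaleC scaleC_scaleC mult.commute)
  show "norm (c *\<^sub>C x) \<le> norm x * cmod c" for x :: 'a
    by (simp add: norm_scaleC)
qed (rule scaleC_add_right)

lemma star_one [simp]: "star (1::'a::unital_cstar_algebra) = 1"
  by (metis mult.right_neutral mult.left_neutral star_mult star_star)

lemma star_scaleR: "star (r *\<^sub>R a) = r *\<^sub>R star (a::'a::unital_cstar_algebra)"
  by (simp add: scaleR_scaleC star_scaleC)

lemma star_zero [simp]: "star (0::'a::unital_cstar_algebra) = 0"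
  using star_scaleR[of 0 "0::'a"] by simp

lemma star_minus: "star (- a) = - star (a::'a::unital_cstar_algebra)"
  using star_scaleR[of "- 1" a] by simp

lemma star_diff: "star (a - b) = star a - star (b::'a::unital_cstar_algebra)"
  using star_add[of a "- b"] by (simp add: star_minus)

lemma norm_star: "norm (star a) = norm (a::'a::unital_cstar_algebra)"
proof -
  have le: "norm b \<le> norm (star b)" for b :: 'a
  proof (cases "b = 0")
    case False
    have "norm b * norm b \<le> norm (star b) * norm b"
      using norm_mult_ineq[of "star b" b] cstar_identity[of b] by (simp add: power2_eq_square)
    then show ?thesis using False by simp
  qed simp
  show ?thesis using le[of a] le[of "star a"] by (simp add: star_star)
qed

lemma bounded_linear_star: "bounded_linear (star :: 'a::unital_cstar_algebra \<Rightarrow> 'a)"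
  by (rule bounded_linear_intro[where K = 1]) (simp_all add: star_add star_scaleR norm_star)

lemma norm_square_self_adjoint:
  "star h = h \<Longrightarrow> norm (h * h) = (norm (h::'a::unital_cstar_algebra))\<^sup>2"
  using cstar_identity[of h] by simp

section \<open>Invertible elements and the spectrum\<close>

definition mutually_inverse :: "'a::monoid_mult \<Rightarrow> 'a \<Rightarrow> bool" where
  "mutually_inverse a b \<longleftrightarrow> a * b = 1 \<and> b * a = 1"

lemma has_two_sided_inverse_iff: "has_two_sided_inverse a \<longleftrightarrow> (\<exists>b. mutually_inverse a b)"
  unfolding has_two_sided_inverse_def mutually_inverse_def ..

lemma mutually_inverse_mult:
  assumes "mutually_inverse a b" "mutually_inverse c d"
  shows "mutually_inverse (a * c) (d * b)"
  using assms unfolding mutually_inverse_def by (metis mult.assoc mult.right_neutral)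

lemma has_two_sided_inverse_mult:
  "has_two_sided_inverse a \<Longrightarrow> has_two_sided_inverse b \<Longrightarrow> has_two_sided_inverse (a * b)"
  unfolding has_two_sided_inverse_iff by (blast intro: mutually_inverse_mult)

lemma mutually_inverse_scaleC:
  fixes a :: "'a::unital_cstar_algebra"
  assumes "mutually_inverse a b" "c \<noteq> 0"
  shows "mutually_inverse (c *\<^sub>C a) ((1 / c) *\<^sub>C b)"
  using assms unfolding mutually_inverse_def
  by (simp add: mult_scaleC_left mult_scaleC_right scaleC_scaleC scaleC_one)

lemma has_two_sided_inverse_scaleC_iff:
  fixes a :: "'a::unital_cstar_algebra"
  assumes "c \<noteq> 0"
  shows "has_two_sided_inverse (c *\<^sub>C a) \<longleftrightarrow> has_two_sided_inverse a"
proof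
  assume "has_two_sided_inverse (c *\<^sub>C a)"
  then obtain b where "mutually_inverse (c *\<^sub>C a) b" unfolding has_two_sided_inverse_iff ..
  then have "mutually_inverse ((1 / c) *\<^sub>C c *\<^sub>C a) ((1 / (1 / c)) *\<^sub>C b)"
    by (rule mutually_inverse_scaleC) (use assms in simp)
  then show "has_two_sided_inverse a"
    using assms unfolding has_two_sided_inverse_iff by (auto simp: scaleC_scaleC scaleC_one)
next
  assume "has_two_sided_inverse a"
  then show "has_two_sided_inverse (c *\<^sub>C a)"
    unfolding has_two_sided_inverse_iff using mutually_inverse_scaleC[OF _ assms] by blast
qed

lemma has_two_sided_inverse_minus:
  fixes a :: "'a::unital_cstar_algebra"
  shows "has_two_sided_inverse (- a) \<longleftrightarrow> has_two_sided_inverse a"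
  using has_two_sided_inverse_scaleC_iff[of "- 1" a] by (simp add: scaleC_minus_left scaleC_one)

lemma has_two_sided_inverse_one_minus:
  fixes x :: "'a::{real_normed_algebra_1, banach}"
  assumes "norm x < 1"
  shows "has_two_sided_inverse (1 - x)"
proof -
  have s: "summable (\<lambda>n. x ^ n)"
    using complete_algebra_summable_geometric[OF assms] .
  have split: "(\<Sum>n. x ^ n) = 1 + (\<Sum>n. x ^ Suc n)"
    using suminf_split_head[OF s] by simp
  have "(1 - x) * (\<Sum>n. x ^ n) = 1"
    using split suminf_mult[OF s, of x] by (simp add: algebra_simps)
  moreover have "(\<Sum>n. x ^ n) * (1 - x) = 1"
    using split suminf_mult2[OF s, of x] by (simp add: algebra_simps power_commutes)
  ultimately show ?thesis unfolding has_two_sided_inverse_def by blast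
qed

lemma has_two_sided_inverse_perturb:
  fixes a :: "'a::{real_normed_algebra_1, banach}"
  assumes "mutually_inverse a b" "norm b * norm x < 1"
  shows "has_two_sided_inverse (a - x)"
proof -
  have "norm (b * x) < 1" using norm_mult_ineq[of b x] assms(2) by linarith
  then have "has_two_sided_inverse (a * (1 - b * x))"
    using assms(1) has_two_sided_inverse_one_minus has_two_sided_inverse_mult has_two_sided_inverse_iff
    by blast
  moreover have "a * (1 - b * x) = a - x"
    using assms(1) unfolding mutually_inverse_def
    by (simp add: right_diff_distrib mult.assoc[symmetric])
  ultimately show ?thesis by simp
qed

lemma norm_le_of_mem_spectrum:
  assumes "z \<in> spectrum a"
  shows "cmod z \<le> norm a"
proof (rule ccontr)
  assume *: "\<not> cmod z \<le> norm a"
  then have z: "z \<noteq> 0" by auto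
  have "norm ((1 / z) *\<^sub>C a) < 1"
    using * z by (simp add: norm_scaleC norm_divide)
  then have "has_two_sided_inverse (z *\<^sub>C (1 - (1 / z) *\<^sub>C a))"
    using has_two_sided_inverse_one_minus has_two_sided_inverse_scaleC_iff[OF z] by blast
  then show False
    using assms z unfolding spectrum_def by (simp add: scaleC_diff_right scaleC_scaleC scaleC_one)
qed

lemma mem_spectrum_shift:
  "z \<in> spectrum (w *\<^sub>C 1 - a) \<longleftrightarrow> w - z \<in> spectrum a"
proof -
  have "z *\<^sub>C 1 - (w *\<^sub>C 1 - a) = - ((w - z) *\<^sub>C 1 - a)"
    by (simp add: scaleC_diff_left)
  then show ?thesis
    unfolding spectrum_def mem_Collect_eq by (simp only: has_two_sided_inverse_minus)
qed

lemma mem_spectrum_scaleC: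
  assumes "c \<noteq> 0"
  shows "c * z \<in> spectrum (c *\<^sub>C a) \<longleftrightarrow> z \<in> spectrum a"
proof -
  have "(c * z) *\<^sub>C 1 - c *\<^sub>C a = c *\<^sub>C (z *\<^sub>C 1 - a)"
    by (simp add: scaleC_diff_right scaleC_scaleC)
  then show ?thesis unfolding spectrum_def by (simp add: has_two_sided_inverse_scaleC_iff[OF assms])
qed

text \<open>A real shift \<open>l\<close> in the imaginary direction moves \<open>z\<close> to \<open>z + \<i>l\<close>, whose squared modulus grows
  by \<open>l\<^sup>2 + 2 l Im z\<close>, whereas the C*-identity bounds the squared norm of \<open>h + \<i>l\<close> by
  \<open>(norm h)\<^sup>2 + l\<^sup>2\<close>.  For \<open>Im z \<noteq> 0\<close> a suitable \<open>l\<close> violates \<open>norm_le_of_mem_spectrum\<close>.\<close>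

lemma spectrum_self_adjoint_real:
  fixes h :: "'a::unital_cstar_algebra"
  assumes h: "star h = h" and z: "z \<in> spectrum h"
  shows "Im z = 0"
proof (rule ccontr)
  assume Im: "Im z \<noteq> 0"
  have key: "(Im z)\<^sup>2 + 2 * (l * Im z) \<le> (norm h)\<^sup>2" for l :: real
  proof -
    define c where "c = \<i> * complex_of_real l"
    define g where "g = c *\<^sub>C 1 + h"
    have "z + c \<in> spectrum g"
    proof -
      have "(z + c) *\<^sub>C 1 - g = z *\<^sub>C 1 - h" by (simp add: g_def scaleC_add_left)
      then show ?thesis using z unfolding spectrum_def by simp
    qed
    then have "cmod (z + c) \<le> norm g" by (rule norm_le_of_mem_spectrum)
    then have "(cmod (z + c))\<^sup>2 \<le> (norm g)\<^sup>2" by (intro power_mono) auto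
    moreover have "(norm g)\<^sup>2 \<le> (norm h)\<^sup>2 + l\<^sup>2"
    proof -
      have "star g * g = (l\<^sup>2) *\<^sub>R 1 + h * h"
        unfolding g_def c_def scaleR_scaleC
        by (simp add: star_add star_scaleC h algebra_simps mult_scaleC_left mult_scaleC_right
            scaleC_scaleC scaleC_minus_left scaleC_diff_right power2_eq_square)
      then have "(norm g)\<^sup>2 \<le> norm ((l\<^sup>2) *\<^sub>R (1::'a)) + norm (h * h)"
        using norm_triangle_ineq cstar_identity[of g] by metis
      then show ?thesis using norm_square_self_adjoint[OF h] by simp
    qed
    moreover have "(cmod (z + c))\<^sup>2 = (Re z)\<^sup>2 + (Im z + l)\<^sup>2"
      by (simp add: cmod_power2 c_def)
    ultimately have "(Re z)\<^sup>2 + (Im z + l)\<^sup>2 \<le> (norm h)\<^sup>2 + l\<^sup>2" by linarith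
    moreover have "(Re z)\<^sup>2 \<ge> 0" by simp
    moreover have "(Im z + l)\<^sup>2 = (Im z)\<^sup>2 + 2 * (l * Im z) + l\<^sup>2"
      by (simp add: power2_sum)
    ultimately show ?thesis by linarith
  qed
  \<comment> \<open>this \<open>l\<close> turns the inequality into \<open>(Im z)\<^sup>2 + 1 \<le> 0\<close>\<close>
  define l where "l = ((norm h)\<^sup>2 + 1) / 2 / Im z"
  have "2 * (l * Im z) = (norm h)\<^sup>2 + 1" using Im by (simp add: l_def)
  then have "(Im z)\<^sup>2 + 1 \<le> 0" using key[of l] by simp
  moreover have "0 \<le> (Im z)\<^sup>2" by simp
  ultimately show False by linarith
qed

section \<open>The norm of a self-adjoint element is its spectral radius\<close>

text \<open>The case of two roots of unity of the identity that the resolvents of \<open>b\<close> at the \<open>n\<close>-th roots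
  of unity average to the resolvent of \<open>b ^ n\<close> at \<open>1\<close>, the resolvent at \<open>z\<close> being the inverse of
  \<open>1 - z b\<close>.  Iterated squaring reaches all \<open>n = 2 ^ m\<close>, and for these
  exponents the C*-identity gives \<open>norm (h ^ n) = norm h ^ n\<close> for self-adjoint \<open>h\<close>.\<close>

lemma mutually_inverse_average:
  fixes b :: "'a::real_normed_algebra_1"
  assumes R: "mutually_inverse (1 - b) R" and S: "mutually_inverse (1 + b) S"
  shows "mutually_inverse (1 - b * b) ((1/2) *\<^sub>R (R + S))"
proof -
  have e: "1 - b * b = (1 + b) * (1 - b)" "1 - b * b = (1 - b) * (1 + b)"
    by (simp_all add: algebra_simps)
  have RS: "(1 - b) * R = 1" "R * (1 - b) = 1" "(1 + b) * S = 1" "S * (1 + b) = 1"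
    using R S unfolding mutually_inverse_def by auto
  have "(1 - b * b) * R = 1 + b" "(1 - b * b) * S = 1 - b"
    by (simp only: e(1) mult.assoc RS mult_1_right) (simp only: e(2) mult.assoc RS mult_1_right)
  moreover have "R * (1 - b * b) = 1 + b" "S * (1 - b * b) = 1 - b"
    by (simp only: e(2) mult.assoc[symmetric] RS mult_1_left)
      (simp only: e(1) mult.assoc[symmetric] RS mult_1_left)
  ultimately show ?thesis
    unfolding mutually_inverse_def
    by (simp add: distrib_left distrib_right flip: scaleR_2)
qed

text \<open>The points \<open>z\<close> and \<open>t z\<close> lie on two concentric circles.  A bound on the difference of the
  resolvents there survives squaring of \<open>h\<close> and \<open>t\<close> with the same \<open>e\<close>, because averages of close
  elements are close.\<close>

definition close_resolvents :: "real \<Rightarrow> real \<Rightarrow> 'a::unital_cstar_algebra \<Rightarrow> bool" where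
  "close_resolvents e t h \<longleftrightarrow> (\<forall>z. cmod z = 1 \<longrightarrow>
     (\<exists>R S. mutually_inverse (1 - z *\<^sub>C h) R \<and> mutually_inverse (1 - t *\<^sub>R z *\<^sub>C h) S \<and> norm (R - S) \<le> e))"

lemma close_resolvents_square:
  assumes "close_resolvents e t h"
  shows "close_resolvents e (t * t) (h * h)"
  unfolding close_resolvents_def
proof (intro allI impI)
  fix z :: complex assume z: "cmod z = 1"
  define y where "y = csqrt z"
  have y: "y * y = z" by (simp add: y_def flip: power2_eq_square)
  have "(cmod y)\<^sup>2 = 1" using y z by (metis norm_mult power2_eq_square)
  then have "cmod y = 1" unfolding power2_eq_1_iff using norm_ge_zero[of y] by linarith
  then have "cmod y = 1" "cmod (- y) = 1" by simp_all
  then obtain R S R' S' where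
      R: "mutually_inverse (1 - y *\<^sub>C h) R" and S: "mutually_inverse (1 - t *\<^sub>R y *\<^sub>C h) S"
      and R': "mutually_inverse (1 - (- y) *\<^sub>C h) R'" and S': "mutually_inverse (1 - t *\<^sub>R (- y) *\<^sub>C h) S'"
      and le: "norm (R - S) \<le> e" "norm (R' - S') \<le> e"
    using assms unfolding close_resolvents_def by metis
  have yh: "(y *\<^sub>C h) * (y *\<^sub>C h) = z *\<^sub>C (h * h)"
    by (simp add: mult_scaleC_left mult_scaleC_right scaleC_scaleC y)
  have "mutually_inverse (1 - (y *\<^sub>C h) * (y *\<^sub>C h)) ((1/2) *\<^sub>R (R + R'))"
    using R R' by (intro mutually_inverse_average) (simp_all add: scaleC_minus_left)
  then have 1: "mutually_inverse (1 - z *\<^sub>C (h * h)) ((1/2) *\<^sub>R (R + R'))"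
    by (simp only: yh)
  have "mutually_inverse (1 - (t *\<^sub>R y *\<^sub>C h) * (t *\<^sub>R y *\<^sub>C h)) ((1/2) *\<^sub>R (S + S'))"
    using S S' by (intro mutually_inverse_average) (simp_all add: scaleC_minus_left)
  then have 2: "mutually_inverse (1 - (t * t) *\<^sub>R z *\<^sub>C (h * h)) ((1/2) *\<^sub>R (S + S'))"
    by (simp only: mult_scaleR_left mult_scaleR_right scaleR_scaleR yh)
  have "norm ((1/2) *\<^sub>R (R + R') - (1/2) *\<^sub>R (S + S')) = norm ((R - S) + (R' - S')) / 2"
    by (simp add: add_diff_add flip: scaleR_diff_right)
  also have "\<dots> \<le> e"
    using norm_triangle_ineq[of "R - S" "R' - S'"] le by simp
  finally show "\<exists>R S. mutually_inverse (1 - z *\<^sub>C (h * h)) R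
      \<and> mutually_inverse (1 - (t * t) *\<^sub>R z *\<^sub>C (h * h)) S \<and> norm (R - S) \<le> e"
    using 1 2 by blast
qed

lemma close_resolvents_power:
  assumes "close_resolvents e t h"
  shows "close_resolvents e (t ^ (2 ^ m)) (h ^ (2 ^ m))"
proof (induction m)
  case (Suc m)
  have "t ^ 2 ^ Suc m = t ^ 2 ^ m * t ^ 2 ^ m" "h ^ 2 ^ Suc m = h ^ 2 ^ m * h ^ 2 ^ m"
    by (simp_all add: mult_2 power_add)
  then show ?case using close_resolvents_square[OF Suc] by (simp only:)
qed (use assms in simp)

lemma star_power: "star (h ^ n) = star (h::'a::unital_cstar_algebra) ^ n"
  by (induction n) (simp_all add: star_mult power_commutes)

lemma norm_power_self_adjoint:
  fixes h :: "'a::unital_cstar_algebra"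
  assumes "star h = h"
  shows "norm (h ^ (2 ^ m)) = norm h ^ (2 ^ m)"
proof (induction m)
  case (Suc m)
  have "norm (h ^ 2 ^ Suc m) = norm (h ^ 2 ^ m * h ^ 2 ^ m)"
    by (simp add: mult_2 power_add)
  also have "\<dots> = (norm (h ^ 2 ^ m))\<^sup>2"
    by (rule norm_square_self_adjoint) (simp add: star_power assms)
  also have "\<dots> = norm h ^ 2 ^ Suc m"
    by (simp add: Suc mult_2 power_add power2_eq_square)
  finally show ?case .
qed simp

lemma norm_mult3_le: "norm (a * b * c) \<le> norm a * norm b * norm (c::'a::real_normed_algebra)"
  by (rule order_trans[OF norm_mult_ineq mult_right_mono[OF norm_mult_ineq norm_ge_zero]])

text \<open>Where the resolvent exists, its norm at most doubles in a small neighbourhood; finitely many of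
  these neighbourhoods cover the disc.\<close>

lemma resolvent_bounded_on_disc:
  fixes h :: "'a::unital_cstar_algebra"
  assumes "\<And>z. cmod z \<le> 1 \<Longrightarrow> has_two_sided_inverse (1 - z *\<^sub>C h)"
  obtains C where "\<And>z. cmod z \<le> 1 \<Longrightarrow> \<exists>R. mutually_inverse (1 - z *\<^sub>C h) R \<and> norm R \<le> C"
proof -
  have "\<forall>z. \<exists>R. cmod z \<le> 1 \<longrightarrow> mutually_inverse (1 - z *\<^sub>C h) R"
    using assms unfolding has_two_sided_inverse_iff by blast
  then obtain R where R: "\<And>z. cmod z \<le> 1 \<Longrightarrow> mutually_inverse (1 - z *\<^sub>C h) (R z)"
    by metis
  define r where "r z = 1 / (2 * (norm (R z) + 1) * (norm h + 1))" for z
  have r: "r z > 0" for z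
    unfolding r_def by (intro divide_pos_pos mult_pos_pos add_nonneg_pos) auto
  have near: "norm (R w) \<le> 2 * norm (R z)" if z: "cmod z \<le> 1" and w: "cmod w \<le> 1" "dist z w < r z" for z w
  proof -
    define x where "x = (w - z) *\<^sub>C h"
    have "norm (R z) * norm x \<le> (norm (R z) + 1) * (r z * (norm h + 1))"
      unfolding x_def norm_scaleC using w(2)
      by (intro mult_mono) (auto simp: dist_norm norm_minus_commute less_imp_le[OF r])
    also have "\<dots> = 1/2"
    proof -
      have "norm (R z) + 1 \<noteq> 0" "norm h + 1 \<noteq> 0"
        by (metis add.commute add_nonneg_pos less_irrefl norm_ge_zero zero_less_one add_pos_nonneg)+
      then show ?thesis unfolding r_def by simp
    qed
    finally have x: "norm (R z) * norm x \<le> 1/2" .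
    \<comment> \<open>the resolvent identity \<open>R w = R z + R z * x * R w\<close> then bounds \<open>R w\<close> by a multiple of \<open>R z\<close>\<close>
    have "R z = R z * ((1 - w *\<^sub>C h) * R w)"
      using R[OF w(1)] unfolding mutually_inverse_def by simp
    also have "\<dots> = R z * ((1 - z *\<^sub>C h) - x) * R w"
      by (simp add: x_def scaleC_diff_left mult.assoc)
    also have "\<dots> = R w - R z * x * R w"
      using R[OF z] unfolding mutually_inverse_def
      by (simp add: right_diff_distrib left_diff_distrib)
    finally have "R w = R z + R z * x * R w" by (metis diff_add_cancel)
    then have "norm (R w) \<le> norm (R z) + norm (R z * x * R w)"
      by (metis norm_triangle_ineq)
    also have "norm (R z * x * R w) \<le> norm (R z) * norm x * norm (R w)"
      by (rule norm_mult3_le)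
    also have "\<dots> \<le> 1/2 * norm (R w)"
      using x by (intro mult_right_mono) auto
    finally show ?thesis by simp
  qed
  obtain F where F: "F \<subseteq> cball 0 1" "finite F" "cball 0 1 \<subseteq> (\<Union>z\<in>F. ball z (r z))"
    by (rule compactE_image[of "cball (0::complex) 1" "cball 0 1" "\<lambda>z. ball z (r z)"])
      (use r in auto)
  show ?thesis
  proof (rule that)
    fix w :: complex assume w: "cmod w \<le> 1"
    then obtain z where z: "z \<in> F" "dist z w < r z" using F(3) by auto
    then have "norm (R w) \<le> 2 * norm (R z)" using near F(1) w by auto
    also have "\<dots> \<le> (\<Sum>z\<in>F. 2 * norm (R z))"
      using z(1) F(2) by (intro member_le_sum) auto
    finally show "\<exists>R'. mutually_inverse (1 - w *\<^sub>C h) R' \<and> norm R' \<le> (\<Sum>z\<in>F. 2 * norm (R z))"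
      using R[OF w] by blast
  qed
qed

text \<open>Rickart's argument.  If the
  spectrum lay inside the open unit disc, the resolvent would be bounded on the closed disc by some \<open>C\<close>, hence
  uniformly continuous, and for \<open>t < 1\<close> near \<open>1\<close> the resolvents on the circles of radius \<open>1\<close> and
  \<open>t\<close> would be close.  By averaging, the resolvents of \<open>h ^ n\<close> at \<open>1\<close> and at \<open>t ^ n\<close> are equally close
  for every \<open>n = 2 ^ m\<close>.  The second tends to \<open>1\<close> as \<open>n\<close> grows, so the first is near \<open>1\<close>
  and \<open>h ^ n\<close> has norm less than \<open>1\<close>; but that norm is \<open>1\<close>.\<close>

lemma self_adjoint_norm_one_spectrum:
  fixes h :: "'a::unital_cstar_algebra"
  assumes h: "star h = h" "norm h = 1"
  shows "\<exists>z\<in>spectrum h. 1 \<le> cmod z"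
proof (rule ccontr)
  assume *: "\<not> (\<exists>z\<in>spectrum h. 1 \<le> cmod z)"
  have inv: "has_two_sided_inverse (1 - z *\<^sub>C h)" if "cmod z \<le> 1" for z
  proof (cases "z = 0")
    case True
    then show ?thesis by (auto simp: has_two_sided_inverse_def)
  next
    case False
    then have "1 \<le> cmod (1 / z)" using that by (simp add: norm_divide field_simps)
    then have "has_two_sided_inverse (z *\<^sub>C ((1 / z) *\<^sub>C 1 - h))"
      using * False unfolding spectrum_def by (auto simp: has_two_sided_inverse_scaleC_iff)
    then show ?thesis using False by (simp add: scaleC_diff_right scaleC_scaleC scaleC_one)
  qed
  obtain C where C: "\<And>z. cmod z \<le> 1 \<Longrightarrow> \<exists>R. mutually_inverse (1 - z *\<^sub>C h) R \<and> norm R \<le> C"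
    using resolvent_bounded_on_disc[OF inv] by blast
  have "0 \<le> C" using C[of 0] by (auto intro: order_trans[OF norm_ge_zero])
  \<comment> \<open>the resolvents at distance \<open>1 - t\<close> differ by at most \<open>C\<^sup>2 * (1 - t)\<close>, which \<open>u = 1 - t\<close> keeps below \<open>1/4\<close>\<close>
  define u where "u = 1 / (4 * (C\<^sup>2 + 1))"
  have C2: "C\<^sup>2 + 1 > 0" by (intro add_nonneg_pos) auto
  then have u: "0 < u" "0 \<le> C\<^sup>2 * u" by (simp_all add: u_def)
  have "u * (C\<^sup>2 + 1) = 1/4" using C2 by (simp add: u_def)
  then have u4: "C\<^sup>2 * u + u = 1/4" by (simp add: algebra_simps)
  define t where "t = 1 - u"
  have t: "0 < t" "t < 1" and Ct: "C\<^sup>2 * (1 - t) \<le> 1/4"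
    unfolding t_def using u u4 by (linarith, linarith, simp)
  have "close_resolvents (1/4) t h"
    unfolding close_resolvents_def
  proof (intro allI impI)
    fix z :: complex assume z: "cmod z = 1"
    obtain R where R: "mutually_inverse (1 - z *\<^sub>C h) R" "norm R \<le> C"
      using C[of z] z by auto
    have "cmod (complex_of_real t * z) \<le> 1" using t z by (simp add: norm_mult)
    then obtain S where S: "mutually_inverse (1 - t *\<^sub>R z *\<^sub>C h) S" "norm S \<le> C"
      using C[of "complex_of_real t * z"] by (auto simp: scaleR_scaleC scaleC_scaleC)
    have "R * ((1 - t *\<^sub>R z *\<^sub>C h) - (1 - z *\<^sub>C h)) * S
        = R * ((1 - t *\<^sub>R z *\<^sub>C h) * S) - (R * (1 - z *\<^sub>C h)) * S"
      by (simp only: right_diff_distrib left_diff_distrib mult.assoc)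
    then have "R - S = R * ((1 - t) *\<^sub>R z *\<^sub>C h) * S"
      using R(1) S(1) unfolding mutually_inverse_def by (simp add: scaleR_diff_left)
    then have "norm (R - S) \<le> norm R * norm ((1 - t) *\<^sub>R z *\<^sub>C h) * norm S"
      by (simp only: norm_mult3_le)
    also have "\<dots> = norm R * (1 - t) * norm S"
      using t z h(2) by (simp add: norm_scaleC)
    also have "\<dots> \<le> C * (1 - t) * C"
      using R(2) S(2) t \<open>0 \<le> C\<close> by (intro mult_mono) auto
    also have "\<dots> \<le> 1/4" using Ct by (simp add: power2_eq_square algebra_simps)
    finally show "\<exists>R S. mutually_inverse (1 - z *\<^sub>C h) R
        \<and> mutually_inverse (1 - t *\<^sub>R z *\<^sub>C h) S \<and> norm (R - S) \<le> 1/4"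
      using R(1) S(1) by blast
  qed
  then have close: "close_resolvents (1/4) (t ^ (2 ^ m)) (h ^ (2 ^ m))" for m
    by (rule close_resolvents_power)
  obtain m where "t ^ m < 1/8"
    using real_arch_pow_inv[of "1/8" t] t by auto
  moreover have "t ^ (2 ^ m) \<le> t ^ m"
    using t by (intro power_decreasing less_imp_le less_exp) auto
  ultimately have "t ^ (2 ^ m) \<le> 1/8" by linarith
  define b where "b = h ^ (2 ^ m)"
  define \<tau> where "\<tau> = t ^ (2 ^ m)"
  have b: "norm b = 1" using norm_power_self_adjoint[OF h(1)] h(2) by (simp add: b_def)
  have \<tau>: "0 \<le> \<tau>" "\<tau> \<le> 1/8" using t \<open>t ^ (2 ^ m) \<le> 1/8\<close> by (simp_all add: \<tau>_def)
  obtain R S where R: "mutually_inverse (1 - b) R" and S: "mutually_inverse (1 - \<tau> *\<^sub>R b) S"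
      and RS: "norm (R - S) \<le> 1/4"
    using close[of m] unfolding close_resolvents_def b_def[symmetric] \<tau>_def[symmetric]
    by (metis norm_one scaleC_one)
  have "S - 1 = \<tau> *\<^sub>R (b * S)"
    using S unfolding mutually_inverse_def by (simp add: left_diff_distrib algebra_simps)
  then have "norm (S - 1) \<le> \<tau> * norm S"
    using norm_mult_ineq[of b S] \<tau>(1) b by (simp add: mult_left_mono)
  also have "\<dots> \<le> 1/8 * norm S" using \<tau>(2) by (intro mult_right_mono) auto
  also have "norm S \<le> norm (S - 1) + 1" using norm_triangle_sub[of S 1] by simp
  finally have "norm (S - 1) \<le> 1/7" by simp
  then have "norm (R - 1) \<le> 1/4 + 1/7"
    using norm_triangle_ineq[of "R - S" "S - 1"] RS by simp
  moreover have "b = (R - 1) * (1 - b)"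
    using R unfolding mutually_inverse_def by (simp add: left_diff_distrib)
  then have "norm b \<le> norm (R - 1) * norm (1 - b)" by (metis norm_mult_ineq)
  moreover have "norm (1 - b) \<le> 2" using norm_triangle_ineq4[of 1 b] b by simp
  then have "norm (R - 1) * norm (1 - b) \<le> norm (R - 1) * 2" by (intro mult_left_mono) auto
  ultimately show False using b by simp
qed

lemma norm_self_adjoint_le_spectrum:
  fixes h :: "'a::unital_cstar_algebra"
  assumes h: "star h = h" and r: "0 \<le> r" "\<And>z. z \<in> spectrum h \<Longrightarrow> cmod z \<le> r"
  shows "norm h \<le> r"
proof (rule ccontr)
  assume *: "\<not> norm h \<le> r"
  define c where "c = complex_of_real (1 / norm h)"
  have "h \<noteq> 0" using * r(1) by auto
  then have c: "c \<noteq> 0" by (simp add: c_def)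
  have "star (c *\<^sub>C h) = c *\<^sub>C h" by (simp add: star_scaleC h c_def)
  moreover have "norm (c *\<^sub>C h) = 1" using \<open>h \<noteq> 0\<close> by (simp add: norm_scaleC c_def norm_divide)
  ultimately obtain z where z: "z \<in> spectrum (c *\<^sub>C h)" "1 \<le> cmod z"
    using self_adjoint_norm_one_spectrum by blast
  then have "z / c \<in> spectrum h" using mem_spectrum_scaleC[OF c, of "z / c" h] c by simp
  then have "cmod (z / c) \<le> r" by (rule r(2))
  moreover have "cmod (z / c) = cmod z * norm h"
    by (simp add: c_def norm_divide norm_mult)
  moreover have "1 * norm h \<le> cmod z * norm h" using z(2) by (intro mult_right_mono) auto
  ultimately show False using * by simp
qed

section \<open>The cone of positive elements\<close>

lemma cstar_positive_iff:
  "cstar_positive a \<longleftrightarrow> star a = a \<and> (\<forall>z\<in>spectrum a. \<exists>r\<ge>0. z = complex_of_real r)"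
  unfolding cstar_positive_def by (auto simp: nonneg_Reals_def)

lemma cstar_positive_star: "cstar_positive a \<Longrightarrow> star a = a"
  unfolding cstar_positive_def by simp

text \<open>Together with its converse \<open>positive_of_norm_shift_le\<close> this describes positivity of a self-adjoint
  element by a norm inequality.  In that form sums and limits of positive elements are visibly positive,
  which the spectrum alone does not show.\<close>

lemma norm_shift_le_of_positive:
  assumes a: "cstar_positive a" and t: "norm a \<le> t"
  shows "norm (t *\<^sub>R 1 - a) \<le> t"
proof (rule norm_self_adjoint_le_spectrum)
  show "star (t *\<^sub>R 1 - a) = t *\<^sub>R 1 - a"
    using cstar_positive_star[OF a] by (simp add: star_diff star_scaleR)
  show "0 \<le> t" using t norm_ge_zero order_trans by blast
  fix z assume "z \<in> spectrum (t *\<^sub>R 1 - a)"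
  then have z: "complex_of_real t - z \<in> spectrum a"
    by (simp add: scaleR_scaleC mem_spectrum_shift)
  then obtain r where r: "0 \<le> r" "complex_of_real t - z = complex_of_real r"
    using a unfolding cstar_positive_iff by blast
  then have "z = complex_of_real (t - r)" by (simp add: algebra_simps)
  moreover have "r \<le> norm a" using norm_le_of_mem_spectrum[OF z] r by simp
  ultimately show "cmod z \<le> t" using r(1) t by (simp only: norm_of_real)
qed

text \<open>The spectrum of \<open>a\<close> is real and contained in the disc with centre and radius \<open>t\<close>.\<close>

lemma positive_of_norm_shift_le:
  assumes a: "star a = a" and t: "norm (t *\<^sub>R 1 - a) \<le> t"
  shows "cstar_positive a"
  unfolding cstar_positive_iff
proof (intro conjI ballI)
  fix z assume z: "z \<in> spectrum a"
  then have zr: "z = complex_of_real (Re z)"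
    using spectrum_self_adjoint_real[OF a] by (simp add: complex_eq_iff)
  have "complex_of_real t - z \<in> spectrum (t *\<^sub>R 1 - a)"
    using z by (simp add: scaleR_scaleC mem_spectrum_shift)
  then have "cmod (complex_of_real t - z) \<le> t"
    using norm_le_of_mem_spectrum t order_trans by blast
  then have "\<bar>t - Re z\<bar> \<le> t"
    by (metis zr norm_of_real of_real_diff)
  then show "\<exists>r\<ge>0. z = complex_of_real r" using zr by (intro exI[of _ "Re z"]) auto
qed (rule a)

lemma cstar_positive_zero: "cstar_positive 0"
  by (rule positive_of_norm_shift_le[of _ 0]) auto

lemma cstar_positive_add:
  assumes a: "cstar_positive a" and b: "cstar_positive b"
  shows "cstar_positive (a + b)"
proof (rule positive_of_norm_shift_le)
  show "star (a + b) = a + b"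
    using a b by (simp add: star_add cstar_positive_star)
  have "norm ((norm a + norm b) *\<^sub>R 1 - (a + b)) = norm ((norm a *\<^sub>R 1 - a) + (norm b *\<^sub>R 1 - b))"
    by (simp add: scaleR_add_left algebra_simps)
  also have "\<dots> \<le> norm a + norm b"
    by (intro norm_triangle_mono norm_shift_le_of_positive a b order_refl)
  finally show "norm ((norm a + norm b) *\<^sub>R 1 - (a + b)) \<le> norm a + norm b" .
qed

lemma cstar_positive_scaleR:
  assumes a: "cstar_positive a" and r: "0 \<le> r"
  shows "cstar_positive (r *\<^sub>R a)"
proof (rule positive_of_norm_shift_le)
  show "star (r *\<^sub>R a) = r *\<^sub>R a" using a by (simp add: star_scaleR cstar_positive_star)
  have "(r * norm a) *\<^sub>R 1 - r *\<^sub>R a = r *\<^sub>R (norm a *\<^sub>R 1 - a)"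
    by (simp add: scaleR_diff_right)
  then show "norm ((r * norm a) *\<^sub>R 1 - r *\<^sub>R a) \<le> r * norm a"
    using norm_shift_le_of_positive[OF a order_refl] r by (simp add: mult_left_mono)
qed

lemma closed_cstar_positive: "closed {a :: 'a::unital_cstar_algebra. cstar_positive a}"
proof (rule closed_sequential_limits[THEN iffD2], intro allI impI, elim conjE)
  fix f :: "nat \<Rightarrow> 'a" and a
  assume f: "\<forall>n. f n \<in> {a. cstar_positive a}" and lim: "f \<longlonglongrightarrow> a"
  have "(\<lambda>n. star (f n)) \<longlonglongrightarrow> star a"
    using bounded_linear.tendsto[OF bounded_linear_star lim] .
  then have "star a = a"
    using f lim cstar_positive_star by (metis (no_types, lifting) LIMSEQ_unique ext mem_Collect_eq)
  moreover have "norm (norm a *\<^sub>R 1 - a) \<le> norm a"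
  proof (rule LIMSEQ_le)
    show "(\<lambda>n. norm (norm (f n) *\<^sub>R 1 - f n)) \<longlonglongrightarrow> norm (norm a *\<^sub>R 1 - a)"
      by (intro tendsto_intros lim)
    show "(\<lambda>n. norm (f n)) \<longlonglongrightarrow> norm a" by (intro tendsto_norm lim)
    show "\<exists>N. \<forall>n\<ge>N. norm (norm (f n) *\<^sub>R 1 - f n) \<le> norm (f n)"
      using f norm_shift_le_of_positive by blast
  qed
  ultimately show "a \<in> {a. cstar_positive a}" using positive_of_norm_shift_le by blast
qed

lemma cstar_positive_norm_minus:
  assumes "star a = a" "norm a \<le> t"
  shows "cstar_positive (t *\<^sub>R 1 - a)"
  by (rule positive_of_norm_shift_le[of _ t]) (use assms in \<open>simp_all add: star_diff star_scaleR\<close>)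

text \<open>Since \<open>b\<close> is at most \<open>norm b\<close> times the unit, so is \<open>a\<close>, which confines the spectrum of \<open>a\<close> to
  \<open>{0..norm b}\<close>.\<close>

lemma norm_mono_positive:
  assumes a: "cstar_positive a" and ab: "cstar_positive (b - a)"
  shows "norm a \<le> norm b"
proof (rule norm_self_adjoint_le_spectrum)
  show "star a = a" using a by (rule cstar_positive_star)
  have "cstar_positive b" using cstar_positive_add[OF a ab] by simp
  then have "cstar_positive (norm b *\<^sub>R 1 - b)"
    by (intro cstar_positive_norm_minus cstar_positive_star) auto
  from cstar_positive_add[OF this ab] have *: "cstar_positive (norm b *\<^sub>R 1 - a)" by simp
  fix z assume z: "z \<in> spectrum a"
  then obtain r where r: "0 \<le> r" "z = complex_of_real r"
    using a unfolding cstar_positive_iff by blast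
  have "complex_of_real (norm b) - z \<in> spectrum (norm b *\<^sub>R 1 - a)"
    using z by (simp add: scaleR_scaleC mem_spectrum_shift)
  then obtain q where q: "0 \<le> q" "complex_of_real (norm b) - z = complex_of_real q"
    using * unfolding cstar_positive_iff by blast
  then have "norm b - r = q" using r(2) by (metis of_real_diff of_real_eq_iff)
  then show "cmod z \<le> norm b" using r q by simp
qed simp

text \<open>If \<open>z = w * w\<close> is in the spectrum of \<open>a * a\<close>, the factorization \<open>z - a * a = (w - a) * (w + a)\<close>
  places \<open>w\<close> or \<open>- w\<close> into the real spectrum of \<open>a\<close>.\<close>

lemma cstar_positive_square:
  assumes a: "star a = a"
  shows "cstar_positive (a * a)"
  unfolding cstar_positive_iff
proof (intro conjI ballI)
  show "star (a * a) = a * a" by (simp add: star_mult a)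
  fix z assume z: "z \<in> spectrum (a * a)"
  define w where "w = csqrt z"
  have w: "w * w = z" by (simp add: w_def flip: power2_eq_square)
  have "z *\<^sub>C 1 - a * a = (w *\<^sub>C 1 - a) * (- ((- w) *\<^sub>C 1 - a))"
    by (simp add: algebra_simps mult_scaleC_left mult_scaleC_right scaleC_scaleC scaleC_minus_left
        scaleC_diff_right w)
  then have "w \<in> spectrum a \<or> - w \<in> spectrum a"
    using z has_two_sided_inverse_mult has_two_sided_inverse_minus
    unfolding spectrum_def mem_Collect_eq by metis
  then have "Im w = 0" using spectrum_self_adjoint_real[OF a] by fastforce
  then have "w = complex_of_real (Re w)" by (simp add: complex_eq_iff)
  then have "z = complex_of_real (Re w * Re w)" using w by (metis of_real_mult)
  then show "\<exists>r\<ge>0. z = complex_of_real r" by (metis zero_le_square)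
qed

lemma cstar_le_trans: "a \<preceq> b \<Longrightarrow> b \<preceq> c \<Longrightarrow> a \<preceq> c"
  using cstar_positive_add[of "b - a" "c - b"] by (simp add: cstar_le_def)

lemma cstar_le_scaleR: "0 \<le> r \<Longrightarrow> a \<preceq> b \<Longrightarrow> r *\<^sub>R a \<preceq> r *\<^sub>R b"
  using cstar_positive_scaleR[of "b - a" r] by (simp add: cstar_le_def scaleR_diff_right)

lemma cstar_le_sum:
  assumes "\<And>k. k \<in> F \<Longrightarrow> a k \<preceq> b k"
  shows "(\<Sum>k\<in>F. a k) \<preceq> (\<Sum>k\<in>F. b k)"
proof (cases "finite F")
  case True
  then show ?thesis using assms
  proof (induction F rule: finite_induct)
    case (insert k F)
    then have "cstar_positive ((b k - a k) + ((\<Sum>k\<in>F. b k) - (\<Sum>k\<in>F. a k)))"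
      by (intro cstar_positive_add) (simp_all add: cstar_le_def)
    then show ?case using insert by (simp add: cstar_le_def add_diff_add)
  qed (simp add: cstar_le_def cstar_positive_zero)
qed (simp add: cstar_le_def cstar_positive_zero)

section \<open>From norm inequalities to order inequalities\<close>

text \<open>With \<open>b = 1 - y\<close> the equation \<open>b * b = 1 - x\<close> reads \<open>y = (x + y * y) / 2\<close>.  The right-hand side is a
  contraction of the ball whose radius \<open>r\<close> is the smaller root of the scalar equation
  \<open>r = (norm x + r\<^sup>2) / 2\<close>.  Uniqueness of the fixed point makes \<open>y\<close> self-adjoint, and \<open>r < 1\<close> keeps
  \<open>b\<close> near the unit.\<close>

lemma self_adjoint_sqrt_one_minus:
  fixes x :: "'a::unital_cstar_algebra"
  assumes x: "star x = x" "norm x < 1"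
  obtains b where "star b = b" "b * b = 1 - x" "norm (1 - b) < 1"
proof -
  define r where "r = 1 - sqrt (1 - norm x)"
  have "(1 - r)\<^sup>2 = 1 - norm x" using x(2) by (simp add: r_def)
  then have r2: "r * r = 2 * r - norm x" by (simp add: power2_eq_square algebra_simps)
  have r: "0 \<le> r" "r < 1" using x(2) by (simp_all add: r_def)
  define f where "f y = (1/2) *\<^sub>R (x + y * y)" for y
  have maps: "f y \<in> cball 0 r" if "y \<in> cball 0 r" for y
  proof -
    have "norm (y * y) \<le> norm y * norm y" by (rule norm_mult_ineq)
    also have "\<dots> \<le> r * r" using that r by (intro mult_mono) auto
    finally have "norm (x + y * y) \<le> norm x + r * r"
      using norm_triangle_ineq[of x "y * y"] by linarith
    then show ?thesis by (simp add: f_def r2)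
  qed
  have lip: "dist (f y) (f z) \<le> r * dist y z" if "y \<in> cball 0 r" "z \<in> cball 0 r" for y z
  proof -
    have "f y - f z = (1/2) *\<^sub>R (y * (y - z) + (y - z) * z)"
      by (simp add: f_def algebra_simps)
    then have "norm (f y - f z) = norm (y * (y - z) + (y - z) * z) / 2" by simp
    also have "\<dots> \<le> (norm y * norm (y - z) + norm (y - z) * norm z) / 2"
      by (intro divide_right_mono norm_triangle_mono norm_mult_ineq) simp
    also have "\<dots> \<le> (r * norm (y - z) + norm (y - z) * r) / 2"
      using that r(1) by (intro divide_right_mono add_mono mult_mono) auto
    finally show ?thesis by (simp add: dist_norm)
  qed
  have "\<exists>!y. y \<in> cball 0 r \<and> f y = y"
  proof (rule Banach_fix)
    show "complete (cball (0::'a) r)" by (simp add: complete_eq_closed)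
    show "cball (0::'a) r \<noteq> {}" using r by simp
  qed (use r maps lip in auto)
  then obtain y where y: "y \<in> cball 0 r" "f y = y"
      and uniq: "\<And>z. z \<in> cball 0 r \<Longrightarrow> f z = z \<Longrightarrow> z = y" by metis
  have "f (star y) = star (f y)" by (simp add: f_def star_scaleR star_add star_mult x)
  then have sy: "star y = y" using uniq[of "star y"] y by (simp add: norm_star)
  have "2 *\<^sub>R y = x + y * y"
    using arg_cong[OF y(2), of "\<lambda>v. 2 *\<^sub>R v"] by (simp add: f_def)
  then have "(1 - y) * (1 - y) = 1 - x" by (simp add: algebra_simps scaleR_2)
  then show ?thesis
    using that[of "1 - y"] sy y(1) r by (simp add: star_diff)
qed

text \<open>Positivity is transported along a deformation.  For invertible positive \<open>c\<close> (such as \<open>d\<close> plus a positive multiple of the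
  unit), \<open>p t * c * p t\<close> is a path of invertible self-adjoint elements from \<open>c\<close> to \<open>b * c * b\<close>, where
  \<open>p t = 1 - t (1 - b)\<close> is invertible because \<open>norm (1 - b) < 1\<close>.  Along such a path positivity is a
  closed condition, and an open one since an invertible positive element stays positive after
  subtraction of a small multiple of the unit.  Connectedness of the unit interval carries positivity from one end to the other.\<close>

lemma cstar_positive_conjugate_near_one:
  fixes b d :: "'a::unital_cstar_algebra"
  assumes b: "star b = b" "norm (1 - b) < 1" and d: "cstar_positive d"
  shows "cstar_positive (b * d * b)"
proof -
  have strict: "cstar_positive (b * (d + e *\<^sub>R 1) * b)" if e: "0 < e" for e
  proof -
    define c where "c = d + e *\<^sub>R 1"
    have one: "cstar_positive (1::'a)" using cstar_positive_square[of "1::'a"] by simp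
    have cpos: "cstar_positive c"
      unfolding c_def using d cstar_positive_scaleR[OF one, of e] e by (intro cstar_positive_add) auto
    have cinv: "has_two_sided_inverse c"
    proof -
      have "- complex_of_real e \<notin> spectrum d"
        using d e unfolding cstar_positive_iff by (auto simp: complex_eq_iff)
      then have "has_two_sided_inverse ((- complex_of_real e) *\<^sub>C 1 - d)"
        unfolding spectrum_def by simp
      moreover have "(- complex_of_real e) *\<^sub>C 1 - d = - c"
        by (simp add: c_def scaleR_scaleC scaleC_minus_left)
      ultimately show ?thesis by (simp add: has_two_sided_inverse_minus)
    qed
    define p where "p t = 1 - t *\<^sub>R (1 - b)" for t :: real
    define f where "f t = p t * c * p t" for t
    have f_star: "star (f t) = f t" for t
      by (simp add: f_def p_def star_mult star_diff star_scaleR b cstar_positive_star[OF cpos] mult.assoc)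
    have f_cont: "continuous_on UNIV f"
      unfolding f_def p_def by (intro continuous_intros)
    have f_inv: "has_two_sided_inverse (f t)" if "t \<in> {0..1}" for t
    proof -
      have "norm (t *\<^sub>R (1 - b)) \<le> 1 * norm (1 - b)"
        using that mult_right_mono[of t 1 "norm (1 - b)"] by simp
      then have "has_two_sided_inverse (p t)"
        unfolding p_def using b(2) by (intro has_two_sided_inverse_one_minus) simp
      then show ?thesis unfolding f_def using cinv by (intro has_two_sided_inverse_mult)
    qed
    define S where "S = {t\<in>{0..1}. cstar_positive (f t)}"
    have "closedin (top_of_set {0..1}) S"
    proof -
      have "closed (f -` {a. cstar_positive a})"
        by (intro closed_vimage closed_cstar_positive f_cont)
      moreover have "S = {0..1} \<inter> (f -` {a. cstar_positive a})" by (auto simp: S_def)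
      ultimately show ?thesis by (metis closedin_closed_Int)
    qed
    moreover have "openin (top_of_set {0..1}) S"
      unfolding openin_contains_ball
    proof (intro conjI ballI)
      fix t assume t: "t \<in> S"
      then have tp: "cstar_positive (f t)" and t01: "t \<in> {0..1}" by (auto simp: S_def)
      obtain g where g: "mutually_inverse (f t) g"
        using f_inv[OF t01] has_two_sided_inverse_iff by blast
      \<comment> \<open>the spectrum of \<open>f t\<close> avoids \<open>{0..<\<delta>}\<close>: there \<open>f t\<close> minus the scalar is a small perturbation of \<open>f t\<close>\<close>
      define \<delta> where "\<delta> = 1 / (norm g + 1)"
      have \<delta>: "0 < \<delta>" unfolding \<delta>_def by (simp add: add_nonneg_pos)
      have low: "cstar_positive (f t - \<delta> *\<^sub>R 1)"
        unfolding cstar_positive_iff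
      proof (intro conjI ballI)
        show "star (f t - \<delta> *\<^sub>R 1) = f t - \<delta> *\<^sub>R 1" by (simp add: star_diff star_scaleR f_star)
        fix z assume z: "z \<in> spectrum (f t - \<delta> *\<^sub>R 1)"
        have eq: "z *\<^sub>C 1 - (f t - \<delta> *\<^sub>R 1) = (z + complex_of_real \<delta>) *\<^sub>C 1 - f t"
          by (simp add: scaleR_scaleC scaleC_add_left)
        then have "z + complex_of_real \<delta> \<in> spectrum (f t)"
          using z unfolding spectrum_def mem_Collect_eq eq by blast
        then obtain r where r: "0 \<le> r" "z + complex_of_real \<delta> = complex_of_real r"
          using tp unfolding cstar_positive_iff by blast
        have "\<delta> \<le> r"
        proof (rule ccontr)
          assume "\<not> \<delta> \<le> r"
          then have "norm g * r \<le> norm g * \<delta>" by (intro mult_left_mono) auto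
          also have "\<dots> < 1"
          proof -
            have "0 < norm g + 1" by (simp add: add_nonneg_pos)
            then show ?thesis by (simp add: \<delta>_def divide_less_eq)
          qed
          finally have "norm g * norm (r *\<^sub>R (1::'a)) < 1" using r(1) by simp
          from has_two_sided_inverse_perturb[OF g this]
          have "has_two_sided_inverse (- (f t - r *\<^sub>R 1))" by (simp only: has_two_sided_inverse_minus)
          then have "has_two_sided_inverse (z *\<^sub>C 1 - (f t - \<delta> *\<^sub>R 1))"
            unfolding eq r(2) by (simp add: scaleR_scaleC)
          then show False using z unfolding spectrum_def by simp
        qed
        moreover have "z = complex_of_real (r - \<delta>)" using r(2) by (simp add: algebra_simps)
        ultimately show "\<exists>r\<ge>0. z = complex_of_real r" by (intro exI[of _ "r - \<delta>"]) simp
      qed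
      obtain \<eta> where \<eta>: "0 < \<eta>" "\<And>s. dist s t < \<eta> \<Longrightarrow> dist (f s) (f t) < \<delta>"
        using f_cont \<delta> unfolding continuous_on_iff by blast
      have "s \<in> S" if "s \<in> ball t \<eta> \<inter> {0..1}" for s
      proof -
        have "dist s t < \<eta>" using that by (simp add: dist_commute)
        then have "norm (f t - f s) \<le> \<delta>"
          using \<eta>(2)[of s] by (simp add: dist_norm norm_minus_commute less_imp_le)
        then have "cstar_positive (\<delta> *\<^sub>R 1 - (f t - f s))"
          by (intro cstar_positive_norm_minus) (simp add: star_diff f_star)
        from cstar_positive_add[OF low this] show ?thesis using that by (simp add: S_def)
      qed
      then show "\<exists>e>0. ball t e \<inter> {0..1} \<subseteq> S" using \<eta>(1) by blast
    qed (auto simp: S_def)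
    moreover have "0 \<in> S" using cpos by (simp add: S_def f_def p_def)
    ultimately have "S = {0..1}"
      using connected_clopen[of "{0..1::real}"] connected_Icc by blast
    then have "1 \<in> S" by simp
    then show ?thesis by (simp add: S_def f_def p_def c_def)
  qed
  have "(\<lambda>n. b * (d + (1 / real (Suc n)) *\<^sub>R 1) * b) \<longlonglongrightarrow> b * (d + 0 *\<^sub>R 1) * b"
    by (intro tendsto_intros lim_1_over_n[THEN LIMSEQ_Suc])
  then have "b * (d + 0 *\<^sub>R 1) * b \<in> {a. cstar_positive a}"
    by (rule closed_sequentially[OF closed_cstar_positive, rotated]) (use strict in simp)
  then show ?thesis by simp
qed

text \<open>This is what turns the hypothesis on norms into an inequality in the algebra.  The idea is to
  rescale \<open>x\<close> by \<open>a\<close>, a scalar multiple of the inverse square root of \<open>G x + e\<close>, so that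
  \<open>G (act a x) = a * G x * a\<close> is bounded by a multiple of the unit.  The norm hypothesis at \<open>act a x\<close> bounds \<open>a * F x * a\<close>
  in the same way, and conjugation by the inverse \<open>b\<close> of \<open>a\<close> gives \<open>F x \<preceq> C (G x + e)\<close>.  Finally \<open>e\<close>
  tends to \<open>0\<close>.\<close>

lemma quadratic_map_le_of_norm_le:
  fixes F G :: "'h \<Rightarrow> 'a::unital_cstar_algebra" and act :: "'a \<Rightarrow> 'h \<Rightarrow> 'h"
  assumes F: "\<And>a x. F (act a x) = a * F x * star a" "\<And>x. cstar_positive (F x)"
    and G: "\<And>a x. G (act a x) = a * G x * star a" "\<And>x. cstar_positive (G x)"
    and C: "0 \<le> C" "\<And>x. norm (F x) \<le> C * norm (G x)"
  shows "F x \<preceq> C *\<^sub>R G x"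
proof -
  have eps: "cstar_positive (C *\<^sub>R (G x + e *\<^sub>R 1) - F x)" if e: "0 < e" for e
  proof -
    define s where "s = norm (G x) + e"
    have s: "0 < s" using e by (simp add: s_def add_nonneg_pos)
    \<comment> \<open>\<open>s * (1 - v) = G x + e\<close> and \<open>norm v < 1\<close>, so \<open>G x + e\<close> has a square root up to the factor \<open>s\<close>\<close>
    define v where "v = (1 / s) *\<^sub>R (norm (G x) *\<^sub>R 1 - G x)"
    have Gx: "star (G x) = G x" using G(2) by (rule cstar_positive_star)
    have "star v = v" by (simp add: v_def star_scaleR star_diff Gx)
    moreover have "norm v < 1"
    proof -
      have "norm v \<le> norm (G x) / s"
        using norm_shift_le_of_positive[OF G(2)[of x] order_refl] s by (simp add: v_def divide_right_mono)
      also have "\<dots> < 1" using s e by (simp add: s_def)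
      finally show ?thesis .
    qed
    ultimately obtain b where b: "star b = b" "b * b = 1 - v" "norm (1 - b) < 1"
      by (rule self_adjoint_sqrt_one_minus)
    have bb: "s *\<^sub>R (b * b) = G x + e *\<^sub>R 1"
      using s by (simp add: b(2) v_def scaleR_diff_right) (simp add: s_def scaleR_add_left)
    have "has_two_sided_inverse (1 - (1 - b))" using b(3) by (rule has_two_sided_inverse_one_minus)
    then obtain a where a: "b * a = 1" "a * b = 1"
      unfolding has_two_sided_inverse_def by auto
    have "star a * b = 1" using a(1) b(1) star_mult[of b a] by simp
    then have sa: "star a = a" by (metis a(1) mult.assoc mult.left_neutral mult.right_neutral)
    have "a * (b * b) * a = (a * b) * (b * a)" by (simp only: mult.assoc)
    then have aba: "a * (b * b) * a = 1" using a by simp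
    have "a * (s *\<^sub>R (b * b)) * a = s *\<^sub>R 1" using aba by simp
    then have "s *\<^sub>R 1 = a * G x * a + e *\<^sub>R (a * a)"
      unfolding bb by (simp add: distrib_left distrib_right)
    then have "s *\<^sub>R 1 - a * G x * a = e *\<^sub>R (a * a)" by simp
    moreover have "cstar_positive (e *\<^sub>R (a * a))"
      using e sa by (intro cstar_positive_scaleR cstar_positive_square) auto
    ultimately have "cstar_positive (s *\<^sub>R 1 - G (act a x))" by (simp add: G(1) sa)
    from norm_mono_positive[OF G(2) this] have "norm (G (act a x)) \<le> s" using s by simp
    then have "norm (F (act a x)) \<le> C * s"
      using C mult_left_mono order_trans by blast
    then have "cstar_positive ((C * s) *\<^sub>R 1 - F (act a x))"
      by (intro cstar_positive_norm_minus cstar_positive_star F(2))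
    then have "cstar_positive (b * ((C * s) *\<^sub>R 1 - a * F x * a) * b)"
      unfolding F(1) sa by (intro cstar_positive_conjugate_near_one b)
    moreover have "b * ((C * s) *\<^sub>R 1 - a * F x * a) * b = C *\<^sub>R (G x + e *\<^sub>R 1) - F x"
    proof -
      have "b * (a * F x * a) * b = (b * a) * F x * (a * b)" by (simp only: mult.assoc)
      then have "b * (a * F x * a) * b = F x" using a by simp
      moreover have "b * ((C * s) *\<^sub>R 1) * b = C *\<^sub>R (s *\<^sub>R (b * b))" by simp
      ultimately show ?thesis unfolding bb[symmetric] by (simp only: right_diff_distrib left_diff_distrib)
    qed
    ultimately show ?thesis by simp
  qed
  have "(\<lambda>n. C *\<^sub>R (G x + (1 / real (Suc n)) *\<^sub>R 1) - F x) \<longlonglongrightarrow> C *\<^sub>R (G x + 0 *\<^sub>R 1) - F x"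
    by (intro tendsto_intros lim_1_over_n[THEN LIMSEQ_Suc])
  then have "C *\<^sub>R (G x + 0 *\<^sub>R 1) - F x \<in> {a. cstar_positive a}"
    by (rule closed_sequentially[OF closed_cstar_positive, rotated]) (use eps in simp)
  then show ?thesis unfolding cstar_le_def by simp
qed

section \<open>Hilbert modules and families of adjointable operators\<close>

context hilbert_module
begin

lemma ip_add_right: "ip z (x + y) = ip z x + ip z y"
  by (metis ip_add_left star_add star_ip)

lemma ip_scaleC_left: "ip (c *\<^sub>C x) y = c *\<^sub>C ip x y"
  using ip_act_left[of "c *\<^sub>C 1" x y] by (simp add: act_scaleC_left act_one mult_scaleC_left)

lemma ip_scaleC_right: "ip x (c *\<^sub>C y) = cnj c *\<^sub>C ip x y"
  by (metis ip_scaleC_left star_ip star_scaleC)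

lemma ip_act_right: "ip x (act a y) = ip x y * star a"
  by (metis ip_act_left star_ip star_mult)

lemma ip_minus_left: "ip (- x) y = - ip x y"
  using ip_scaleC_left[of "- 1" x y] by (simp add: scaleC_minus_left scaleC_one)

lemma ip_minus_right: "ip x (- y) = - ip x y"
  using ip_scaleC_right[of x "- 1" y] by (simp add: scaleC_minus_left scaleC_one)

lemma ip_diff_left: "ip (x - y) z = ip x z - ip y z"
  using ip_add_left[of x "- y" z] by (simp add: ip_minus_left)

lemma ip_diff_right: "ip z (x - y) = ip z x - ip z y"
  using ip_add_right[of z x "- y"] by (simp add: ip_minus_right)

lemma norm_ip_self: "norm (ip x x) = (norm x)\<^sup>2"
  by (simp add: norm_eq[of x])

lemma ip_polarization:
  "4 *\<^sub>R ip x y = (ip (x + y) (x + y) - ip (x - y) (x - y))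
     + \<i> *\<^sub>C (ip (x + \<i> *\<^sub>C y) (x + \<i> *\<^sub>C y) - ip (x - \<i> *\<^sub>C y) (x - \<i> *\<^sub>C y))"
proof -
  have "ip (x + y) (x + y) - ip (x - y) (x - y) = 2 *\<^sub>R (ip x y + ip y x)"
    by (simp add: ip_add_left ip_add_right ip_diff_left ip_diff_right scaleR_2 algebra_simps)
  moreover have "ip (x + \<i> *\<^sub>C y) (x + \<i> *\<^sub>C y) - ip (x - \<i> *\<^sub>C y) (x - \<i> *\<^sub>C y)
      = 2 *\<^sub>R (\<i> *\<^sub>C ip y x - \<i> *\<^sub>C ip x y)"
    by (simp add: ip_add_left ip_add_right ip_diff_left ip_diff_right ip_scaleC_left ip_scaleC_right
        scaleC_minus_left scaleC_add_right scaleC_diff_right scaleR_2 algebra_simps)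
  moreover have "\<i> *\<^sub>C 2 *\<^sub>R (\<i> *\<^sub>C ip y x - \<i> *\<^sub>C ip x y) = 2 *\<^sub>R (ip x y - ip y x)"
  proof -
    have "\<i> *\<^sub>C (\<i> *\<^sub>C ip y x - \<i> *\<^sub>C ip x y) = ip x y - ip y x"
      by (simp add: scaleC_diff_right scaleC_scaleC scaleC_minus_left scaleC_one)
    then show ?thesis by (simp only: linear_scale[OF bounded_linear.linear[OF bounded_linear_scaleC]])
  qed
  ultimately show ?thesis by (simp add: scaleR_add_right scaleR_diff_right flip: scaleR_add_left)
qed

lemma norm_ip_le_square: "norm (ip x y) \<le> (norm x + norm y)\<^sup>2"
proof -
  have le: "norm (ip u u) \<le> (norm x + norm y)\<^sup>2" if "norm u \<le> norm x + norm y" for u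
    unfolding norm_ip_self using that by (intro power_mono) auto
  have "4 * norm (ip x y) = norm (4 *\<^sub>R ip x y)" by simp
  also have "\<dots> \<le> (norm (ip (x + y) (x + y)) + norm (ip (x - y) (x - y)))
      + (norm (ip (x + \<i> *\<^sub>C y) (x + \<i> *\<^sub>C y)) + norm (ip (x - \<i> *\<^sub>C y) (x - \<i> *\<^sub>C y)))"
    unfolding ip_polarization
    by (intro norm_triangle_mono norm_triangle_ineq4) (simp add: norm_scaleC norm_triangle_ineq4)
  also have "\<dots> \<le> ((norm x + norm y)\<^sup>2 + (norm x + norm y)\<^sup>2) + ((norm x + norm y)\<^sup>2 + (norm x + norm y)\<^sup>2)"
    by (intro add_mono le)
      (simp_all add: norm_triangle_ineq norm_triangle_ineq4
        order_trans[OF norm_triangle_ineq] order_trans[OF norm_triangle_ineq4] norm_scaleC)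
  finally show ?thesis by simp
qed

text \<open>Polarization expresses the inner product by its values on the diagonal, where \<open>norm_eq\<close> applies.
  The constant \<open>4\<close> is not sharp, but any bound makes the inner product continuous.\<close>

lemma bounded_bilinear_ip: "bounded_bilinear ip"
proof
  show "ip (r *\<^sub>R x) y = r *\<^sub>R ip x y" for r x y
    by (simp add: scaleR_scaleC ip_scaleC_left)
  show "ip x (r *\<^sub>R y) = r *\<^sub>R ip x y" for r x y
    by (simp add: scaleR_scaleC ip_scaleC_right)
  note ipR = \<open>\<And>r x y. ip (r *\<^sub>R x) y = r *\<^sub>R ip x y\<close> \<open>\<And>r x y. ip x (r *\<^sub>R y) = r *\<^sub>R ip x y\<close>
  have "norm (ip x y) \<le> norm x * norm y * 4" for x y
  proof (cases "x = 0 \<or> y = 0")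
    case True
    then show ?thesis using ip_diff_left[of x x y] ip_diff_right[of x y y] by auto
  next
    case False
    have "norm (ip ((1 / norm x) *\<^sub>R x) ((1 / norm y) *\<^sub>R y)) \<le> (1 + 1)\<^sup>2"
      using norm_ip_le_square[of "(1 / norm x) *\<^sub>R x" "(1 / norm y) *\<^sub>R y"] False by simp
    then have "norm (ip x y) / (norm x * norm y) \<le> 4" by (simp add: ipR mult.commute)
    then show ?thesis using False by (simp add: field_simps)
  qed
  then show "\<exists>K. \<forall>x y. norm (ip x y) \<le> norm x * norm y * K" by blast
qed (simp_all add: ip_add_left ip_add_right)

lemma strongly_measurable_ip:
  assumes "strongly_measurable M f"
  shows "strongly_measurable M (\<lambda>w. ip (f w) (f w))"
proof (rule strongly_measurable_compose2[where p = ip, OF _ assms assms])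
  show "continuous_on UNIV (\<lambda>(x, y). ip x y)"
    unfolding case_prod_beta
    by (intro bounded_bilinear.continuous_on[OF bounded_bilinear_ip] continuous_intros)
qed

lemma ip_self_scaleC: "ip (c *\<^sub>C x) (c *\<^sub>C x) = (cmod c)\<^sup>2 *\<^sub>R ip x x"
proof -
  have "cnj c * c = complex_of_real ((cmod c)\<^sup>2)"
    by (simp only: complex_norm_square mult.commute)
  then show ?thesis
    by (simp only: ip_scaleC_left ip_scaleC_right scaleC_scaleC scaleR_scaleC mult.commute)
qed

text \<open>The case of two summands is the parallelogram law: \<open>2 ip z z + 2 ip v v - ip (z + v) (z + v)\<close> is
  \<open>ip (z - v) (z - v)\<close>.  Each further summand doubles the factor.\<close>

lemma ip_sum_le:
  assumes "finite F"
  shows "ip (\<Sum>k\<in>F. y k) (\<Sum>k\<in>F. y k) \<preceq> (\<Sum>k\<in>F. 2 ^ card F *\<^sub>R ip (y k) (y k))"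
  using assms
proof (induction F rule: finite_induct)
  case empty
  have "ip 0 0 = 0" using ip_diff_left[of 0 0 0] by simp
  then show ?case by (simp add: cstar_le_def cstar_positive_zero)
next
  case (insert k F)
  define z where "z = y k"
  define v where "v = (\<Sum>j\<in>F. y j)"
  define Q where "Q = (\<Sum>j\<in>F. ip (y j) (y j))"
  define c :: real where "c = 2 ^ card F"
  have c: "1 \<le> c" by (simp add: c_def)
  have IH: "cstar_positive (c *\<^sub>R Q - ip v v)"
    using insert.IH by (simp add: cstar_le_def v_def Q_def c_def scaleR_sum_right)
  have "cstar_positive (ip (z - v) (z - v) + (2 *\<^sub>R (c *\<^sub>R Q - ip v v) + (2 * c - 2) *\<^sub>R ip z z))"
    using c by (intro cstar_positive_add cstar_positive_scaleR IH ip_positive) auto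
  also have "ip (z - v) (z - v) + (2 *\<^sub>R (c *\<^sub>R Q - ip v v) + (2 * c - 2) *\<^sub>R ip z z)
      = (2 * c) *\<^sub>R (ip z z + Q) - ip (z + v) (z + v)"
    by (simp add: ip_add_left ip_add_right ip_diff_left ip_diff_right scaleR_add_right
        scaleR_diff_left scaleR_diff_right scaleR_2)
  finally show ?case
    using insert.hyps
    by (simp add: cstar_le_def z_def v_def Q_def c_def scaleR_sum_right[symmetric])
qed

lemma ip_all_eq_zero: "(\<And>y. ip u y = 0) \<Longrightarrow> u = 0"
  using ip_definite by blast

lemma adjointable_act:
  assumes "adjointable ip T"
  shows "T (act a x) = act a (T x)"
proof -
  obtain S where S: "\<And>x y. ip (T x) y = ip x (S y)" using assms unfolding adjointable_def by blast
  have "T (act a x) - act a (T x) = 0"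
    by (rule ip_all_eq_zero) (simp add: ip_diff_left ip_act_left S)
  then show ?thesis by simp
qed

lemma ip_adj:
  assumes "adjointable ip T"
  shows "ip (T x) y = ip x (adj ip T y)"
proof -
  obtain S where S: "\<forall>x y. ip (T x) y = ip x (S y)" using assms unfolding adjointable_def by blast
  have "S' = S" if S': "\<forall>x y. ip (T x) y = ip x (S' y)" for S'
  proof
    fix y
    have "ip (S' y - S y) (S' y - S y) = 0"
      using S S' by (metis eq_iff_diff_eq_0 ip_diff_right)
    then show "S' y = S y" using ip_definite by fastforce
  qed
  then have "adj ip T = S" unfolding adj_def by (intro the_equality) (use S in blast)+
  then show ?thesis using S by blast
qed

lemma adjointable_sum_scaleC:
  assumes "\<And>k. k \<in> F \<Longrightarrow> adjointable ip (T k)"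
  shows "adjointable ip (\<lambda>x. \<Sum>k\<in>F. c k *\<^sub>C T k x)"
proof -
  obtain S where S: "\<And>k x y. k \<in> F \<Longrightarrow> ip (T k x) y = ip x (S k y)"
    using assms unfolding adjointable_def by metis
  interpret bounded_bilinear ip by (rule bounded_bilinear_ip)
  have "ip (\<Sum>k\<in>F. c k *\<^sub>C T k x) y = ip x (\<Sum>k\<in>F. cnj (c k) *\<^sub>C S k y)" for x y
    by (simp add: sum_left sum_right ip_scaleC_left ip_scaleC_right S)
  then show ?thesis unfolding adjointable_def
    by (intro exI[of _ "\<lambda>y. \<Sum>k\<in>F. cnj (c k) *\<^sub>C S k y"]) blast
qed

end

lemma has_strong_bochner_integral_cstar_positive:
  assumes "has_strong_bochner_integral M f I" "\<And>w. w \<in> space M \<Longrightarrow> cstar_positive (f w)"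
  shows "cstar_positive I"
  using has_strong_bochner_integral_closed_convex_cone[of "{a. cstar_positive a}" M f I] assms
  by (simp add: closed_cstar_positive cstar_positive_zero cstar_positive_add cstar_positive_scaleR)

context hilbert_module
begin

text \<open>Adjointable operators commute with the action, so the integral is a quadratic map as required by
  \<open>quadratic_map_le_of_norm_le\<close>.\<close>

lemma integral_ip_operator_family:
  assumes adj: "\<forall>w\<in>space M. adjointable ip (T w)"
    and int: "\<And>x. strong_bochner_integrable M (\<lambda>w. ip (T w x) (T w x))"
  shows "strong_bochner_integral M (\<lambda>w. ip (T w (act a x)) (T w (act a x)))
           = a * strong_bochner_integral M (\<lambda>w. ip (T w x) (T w x)) * star a" (is ?act)
    and "cstar_positive (strong_bochner_integral M (\<lambda>w. ip (T w x) (T w x)))" (is ?pos)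
proof -
  have "bounded_linear (\<lambda>y. a * y * star a)"
    by (intro bounded_linear_mult_const bounded_linear_const_mult bounded_linear_ident)
  from has_strong_bochner_integral_bounded_linear[OF this has_strong_bochner_integral_integral[OF int]]
  have "has_strong_bochner_integral M (\<lambda>w. a * ip (T w x) (T w x) * star a)
      (a * strong_bochner_integral M (\<lambda>w. ip (T w x) (T w x)) * star a)" .
  then have "has_strong_bochner_integral M (\<lambda>w. ip (T w (act a x)) (T w (act a x)))
      (a * strong_bochner_integral M (\<lambda>w. ip (T w x) (T w x)) * star a)"
    by (rule has_strong_bochner_integral_cong)
      (use adj in \<open>simp add: adjointable_act ip_act_left ip_act_right mult.assoc\<close>)
  then show ?act by (rule strong_bochner_integral_eq)
  show ?pos
    using has_strong_bochner_integral_integral[OF int] ip_positive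
    by (rule has_strong_bochner_integral_cstar_positive)
qed

text \<open>Pointwise, \<open>ip_sum_le\<close> bounds the inner square of the sum by a combination of the integrable inner
  squares of the summands.  This gives integrability by domination, and the upper bound after integration.\<close>

lemma bessel_sum:
  assumes F: "finite F"
    and meas: "\<And>k. k \<in> F \<Longrightarrow> strongly_measurable M (\<lambda>w. T k w x)"
    and int: "\<And>k. k \<in> F \<Longrightarrow> strong_bochner_integrable M (\<lambda>w. ip (T k w x) (T k w x))"
    and bound: "\<And>k. k \<in> F \<Longrightarrow> strong_bochner_integral M (\<lambda>w. ip (T k w x) (T k w x)) \<preceq> B k *\<^sub>R ip x x"
  shows "strong_bochner_integrable M (\<lambda>w. ip (\<Sum>k\<in>F. c k *\<^sub>C T k w x) (\<Sum>k\<in>F. c k *\<^sub>C T k w x))"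
      (is "strong_bochner_integrable M ?f")
    and "strong_bochner_integral M (\<lambda>w. ip (\<Sum>k\<in>F. c k *\<^sub>C T k w x) (\<Sum>k\<in>F. c k *\<^sub>C T k w x))
      \<preceq> (\<Sum>k\<in>F. 2 ^ card F * (cmod (c k))\<^sup>2 * B k) *\<^sub>R ip x x"
proof -
  define m where "m k = 2 ^ card F * (cmod (c k))\<^sup>2" for k
  have m: "0 \<le> m k" for k by (simp add: m_def)
  define g where "g w = (\<Sum>k\<in>F. m k *\<^sub>R ip (T k w x) (T k w x))" for w
  define D where "D k = strong_bochner_integral M (\<lambda>w. ip (T k w x) (T k w x))" for k
  have g: "has_strong_bochner_integral M g (\<Sum>k\<in>F. m k *\<^sub>R D k)"
    unfolding g_def D_def
    by (intro has_strong_bochner_integral_sum F has_strong_bochner_integral_integral int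
        has_strong_bochner_integral_bounded_linear[OF bounded_linear_scaleR_right])
  have fg: "?f w \<preceq> g w" for w
    using ip_sum_le[OF F, of "\<lambda>k. c k *\<^sub>C T k w x"] by (simp add: g_def m_def ip_self_scaleC)
  have "strongly_measurable M ?f"
    by (intro strongly_measurable_ip strongly_measurable_sum F meas
        strongly_measurable_bounded_linear[OF bounded_linear_scaleC])
  then show int_f: "strong_bochner_integrable M ?f"
    by (rule strong_bochner_integrable_dominated[OF _ g])
      (use fg ip_positive norm_mono_positive in \<open>auto simp: cstar_le_def\<close>)
  have "strong_bochner_integral M ?f \<preceq> (\<Sum>k\<in>F. m k *\<^sub>R D k)"
    using has_strong_bochner_integral_cstar_positive[OF has_strong_bochner_integral_diff[OF g
          has_strong_bochner_integral_integral[OF int_f]]] fg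
    by (simp add: cstar_le_def)
  also have "(\<Sum>k\<in>F. m k *\<^sub>R D k) \<preceq> (\<Sum>k\<in>F. m k *\<^sub>R B k *\<^sub>R ip x x)"
    using m bound by (intro cstar_le_sum cstar_le_scaleR) (auto simp: D_def)
  finally (cstar_le_trans) show "strong_bochner_integral M ?f
      \<preceq> (\<Sum>k\<in>F. 2 ^ card F * (cmod (c k))\<^sup>2 * B k) *\<^sub>R ip x x"
    by (simp add: m_def scaleR_sum_left)
qed

end

section \<open>Frames from linear combinations\<close>

theorem theorem5p5:
  fixes M :: "'w measure"
    and act :: "'a::unital_cstar_algebra \<Rightarrow> 'h::{complex_normed_vector, banach} \<Rightarrow> 'h"
    and ip :: "'h \<Rightarrow> 'h \<Rightarrow> 'a"
    and K :: "'h \<Rightarrow> 'h"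
    and n :: nat
    and T :: "nat \<Rightarrow> 'w \<Rightarrow> 'h \<Rightarrow> 'h"
    and A B :: "nat \<Rightarrow> real"
    and \<alpha> :: "nat \<Rightarrow> complex"
  assumes "hilbert_module act ip"
    and "adjointable ip K"
    and "n \<ge> 1"
    and "\<And>k x. k \<in> {1..n} \<Longrightarrow> strongly_measurable M (\<lambda>w. T k w x)"
    and "\<And>k. k \<in> {1..n} \<Longrightarrow>
           continuous_K_operator_frame_with_bounds M ip K (T k) (A k) (B k)"
  shows "((\<exists>c>0. \<exists>p\<in>{1..n}. \<forall>x.
            c * family_norm M ip (\<lambda>w. T p w x)
              \<le> family_norm M ip (\<lambda>w. \<Sum>k=1..n. \<alpha> k *\<^sub>C T k w x))
          \<longrightarrow> continuous_K_operator_frame M ip K (\<lambda>w x. \<Sum>k=1..n. \<alpha> k *\<^sub>C T k w x))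
       \<and> (co_isometry ip K
          \<longrightarrow> continuous_K_operator_frame M ip K (\<lambda>w x. \<Sum>k=1..n. \<alpha> k *\<^sub>C T k w x)
          \<longrightarrow> (\<exists>c>0. \<exists>p\<in>{1..n}. \<forall>x.
                c * family_norm M ip (\<lambda>w. T p w x)
                  \<le> family_norm M ip (\<lambda>w. \<Sum>k=1..n. \<alpha> k *\<^sub>C T k w x)))"
proof -
  interpret hilbert_module act ip by (rule assms(1))
  define S where "S w x = (\<Sum>k=1..n. \<alpha> k *\<^sub>C T k w x)" for w x
  define D where "D k x = strong_bochner_integral M (\<lambda>w. ip (T k w x) (T k w x))" for k x
  define DS where "DS x = strong_bochner_integral M (\<lambda>w. ip (S w x) (S w x))" for x
  have frame: "0 < A k" "0 < B k" "\<forall>w\<in>space M. adjointable ip (T k w)"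
      "strong_bochner_integrable M (\<lambda>w. ip (T k w x) (T k w x))"
      "A k *\<^sub>R ip (adj ip K x) (adj ip K x) \<preceq> D k x" "D k x \<preceq> B k *\<^sub>R ip x x"
    if "k \<in> {1..n}" for k x
    using assms(5)[OF that] unfolding continuous_K_operator_frame_with_bounds_def D_def by auto
  have D_act: "D k (act a x) = a * D k x * star a" and D_pos: "cstar_positive (D k x)"
    if "k \<in> {1..n}" for k a x
    unfolding D_def by (intro integral_ip_operator_family frame that)+
  have S_adj: "\<forall>w\<in>space M. adjointable ip (S w)"
    unfolding S_def using frame(3) by (intro ballI adjointable_sum_scaleC) blast
  have S_int: "strong_bochner_integrable M (\<lambda>w. ip (S w x) (S w x))" for x
    unfolding S_def using frame(6)
    by (intro bessel_sum(1)[where B = B] assms(4) frame(4)) (auto simp: D_def)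
  have S_act: "DS (act a x) = a * DS x * star a" and S_pos: "cstar_positive (DS x)" for a x
    unfolding DS_def by (intro integral_ip_operator_family S_adj S_int)+
  define \<beta> where "\<beta> = (\<Sum>k=1..n. 2 ^ card {1..n} * (cmod (\<alpha> k))\<^sup>2 * B k)"
  have \<beta>: "0 \<le> \<beta>" unfolding \<beta>_def using frame(2) by (intro sum_nonneg mult_nonneg_nonneg) (auto intro: less_imp_le)
  have S_upper: "DS x \<preceq> (\<beta> + 1) *\<^sub>R ip x x" for x
  proof (rule cstar_le_trans)
    show "DS x \<preceq> \<beta> *\<^sub>R ip x x"
      unfolding DS_def S_def \<beta>_def using frame(6)
      by (intro bessel_sum(2) assms(4) frame(4)) (auto simp: D_def)
    show "\<beta> *\<^sub>R ip x x \<preceq> (\<beta> + 1) *\<^sub>R ip x x"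
      by (simp add: cstar_le_def scaleR_add_left ip_positive)
  qed
  \<comment> \<open>The norm inequality becomes an order inequality between the integrals, and the lower bound of
    the \<open>p\<close>-th frame passes through it.\<close>
  have forward: "continuous_K_operator_frame M ip K S"
    if c: "0 < c" and p: "p \<in> {1..n}"
      and le: "\<And>x. c * family_norm M ip (\<lambda>w. T p w x) \<le> family_norm M ip (\<lambda>w. S w x)" for c p
  proof -
    have "norm (D p x) \<le> (1 / c\<^sup>2) * norm (DS x)" for x
    proof -
      have "(c * sqrt (norm (D p x)))\<^sup>2 \<le> (sqrt (norm (DS x)))\<^sup>2"
        using le[of x] c unfolding family_norm_def D_def DS_def by (intro power_mono) auto
      then show ?thesis using c by (simp add: power_mult_distrib field_simps)
    qed
    then have "D p x \<preceq> (1 / c\<^sup>2) *\<^sub>R DS x" for x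
      by (intro quadratic_map_le_of_norm_le[where act = act] D_act D_pos p S_act S_pos) auto
    then have "c\<^sup>2 *\<^sub>R D p x \<preceq> c\<^sup>2 *\<^sub>R (1 / c\<^sup>2) *\<^sub>R DS x" for x
      by (intro cstar_le_scaleR) auto
    then have "c\<^sup>2 *\<^sub>R D p x \<preceq> DS x" for x
      using c by simp
    moreover have "c\<^sup>2 *\<^sub>R A p *\<^sub>R ip (adj ip K x) (adj ip K x) \<preceq> c\<^sup>2 *\<^sub>R D p x" for x
      using frame(5)[OF p] by (intro cstar_le_scaleR) auto
    ultimately have lower: "(c\<^sup>2 * A p) *\<^sub>R ip (adj ip K x) (adj ip K x) \<preceq> DS x" for x
      using cstar_le_trans by (metis scaleR_scaleR)
    have "0 < c\<^sup>2 * A p" using c frame(1)[OF p] by simp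
    then have "continuous_K_operator_frame_with_bounds M ip K S (c\<^sup>2 * A p) (\<beta> + 1)"
      unfolding continuous_K_operator_frame_with_bounds_def
      using S_adj S_int lower S_upper \<beta> unfolding DS_def by auto
    then show ?thesis unfolding continuous_K_operator_frame_def by blast
  qed
  \<comment> \<open>For a co-isometry the lower bound is a multiple of \<open>ip x x\<close> itself, which dominates every
    single frame; hence any index serves, and the first one is taken.\<close>
  have backward: "\<exists>c>0. \<exists>p\<in>{1..n}. \<forall>x.
      c * family_norm M ip (\<lambda>w. T p w x) \<le> family_norm M ip (\<lambda>w. S w x)"
    if co: "co_isometry ip K" and fr: "continuous_K_operator_frame M ip K S"
  proof -
    obtain a where a: "0 < a" "\<And>x. a *\<^sub>R ip (adj ip K x) (adj ip K x) \<preceq> DS x"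
      using fr unfolding continuous_K_operator_frame_def continuous_K_operator_frame_with_bounds_def DS_def
      by blast
    have "ip (adj ip K x) (adj ip K x) = ip x x" for x
      using co ip_adj[OF assms(2), of "adj ip K x" x]
      unfolding co_isometry_def by (metis comp_apply id_apply)
    then have lower: "a *\<^sub>R ip x x \<preceq> DS x" for x using a(2)[of x] by simp
    have one: "1 \<in> {1..n}" using assms(3) by simp
    define c where "c = sqrt (a / B 1)"
    have c: "0 < c" using a(1) frame(2)[OF one] by (simp add: c_def)
    have "c * family_norm M ip (\<lambda>w. T 1 w x) \<le> family_norm M ip (\<lambda>w. S w x)" for x
    proof -
      have "norm (D 1 x) \<le> B 1 * norm (ip x x)"
        using norm_mono_positive[where a = "D 1 x" and b = "B 1 *\<^sub>R ip x x", OF D_pos[OF one]] frame(6)[OF one, of x] frame(2)[OF one]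
        by (simp add: cstar_le_def)
      moreover have "a * norm (ip x x) \<le> norm (DS x)"
        using norm_mono_positive[OF cstar_positive_scaleR[OF ip_positive[of x], of a], of "DS x"]
          lower[of x] a(1) by (simp add: cstar_le_def)
      ultimately have "(a / B 1) * norm (D 1 x) \<le> norm (DS x)"
      proof -
        have "(a / B 1) * norm (D 1 x) \<le> (a / B 1) * (B 1 * norm (ip x x))"
          using \<open>norm (D 1 x) \<le> B 1 * norm (ip x x)\<close> a(1) frame(2)[OF one] by (intro mult_left_mono) auto
        also have "\<dots> = a * norm (ip x x)" using frame(2)[OF one] by simp
        finally show ?thesis using \<open>a * norm (ip x x) \<le> norm (DS x)\<close> by simp
      qed
      then have "sqrt ((a / B 1) * norm (D 1 x)) \<le> sqrt (norm (DS x))" by simp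
      then show ?thesis
        unfolding family_norm_def D_def[symmetric] DS_def[symmetric] c_def real_sqrt_mult .
    qed
    then show ?thesis using c one by blast
  qed
  show ?thesis
    using forward backward unfolding S_def by blast
qed

end
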